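(* Let $U_q(\mathfrak g)$ be the quantum Borcherds-Bozec algebra associated with a Borcherds-Cartan datum, let $\lambda\in P^{+}$ be a dominant integral weight, and let $V(\lambda)=U_q(\mathfrak g)\,v_\lambda$ be the irreducible highest weight module with highest weight $\lambda$ and highest weight vector $v_\lambda$. Then: (a) If $i\in I^{\mathrm{re}}$, then $f_i^{\langle h_i,\lambda\rangle+1}v_\lambda=0$. (b) If $i\in I^{\mathrm{im}}$ and $\langle h_i,\lambda\rangle=0$, then $f_{ik}v_\lambda=0$ for all $k>0$.
   Context: **Borcherds-Cartan datum.** $I$ is a (finite or countably infinite) index set. An even symmetrizable Borcherds-Cartan matrix is an integer matrix $A=(a_{ij})_{i,j\in I}$ such that $a_{ii}\in\{2,0,-2,-4,\dots\}$, $a_{ij}\le 0$ for $i\ne j$, and there is $D=\mathrm{diag}(s_i\in\mathbf{Z}_{>0}\mid i\in I)$ with $DA$ symmetric. Put $I^{\mathrm{re}}=\{i: a_{ii}=2\}$, $I^{\mathrm{im}}=\{i: a_{ii}\le 0\}$. A Borcherds-Cartan datum consists of such $A$ (with $D$), a free abelian group $P$ (weight lattice), $P^{\vee}=\mathrm{Hom}(P,\mathbf{Z})$ with pairing $\langle\ ,\ \rangle$, simple roots $\alpha_i\in P$ and simple coroots $h_i\in P^{\vee}$ $(i\in I)$ such that $\langle h_i,\alpha_j\rangle=a_{ij}$, the $\alpha_i$ are linearly independent over $\mathbf{Q}$, and for each $i$ there is $\Lambda_i\in P$ with $\langle h_j,\Lambda_i\rangle=\delta_{ij}$ for all $j$.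 $P^+=\{\lambda\in P:\langle h_i,\lambda\rangle\ge0\ \forall i\in I\}$. **Notation.** $q$ is an indeterminate, $q_i=q^{s_i}$, $q_{(i)}=q_i^{a_{ii}/2}$, $K_i=q^{s_ih_i}$. For $i\in I^{\mathrm{re}}$: $[n]_i=\frac{q_i^{n}-q_i^{-n}}{q_i-q_i^{-1}}$, $[n]_i!=[n]_i\cdots[1]_i$, $\left[\begin{smallmatrix}n\\k\end{smallmatrix}\right]_i=\frac{[n]_i!}{[k]_i!\,[n-k]_i!}$. $I^{\infty}=(I^{\mathrm{re}}\times\{1\})\cup(I^{\mathrm{im}}\times\mathbf{Z}_{>0})$; for $i\in I^{\mathrm{re}}$ write $i=(i,1)$, $e_i=e_{i1}$, $f_i=f_{i1}$. Convention: $e_{i0}=f_{i0}=1$. Fix $\tau_{il}\in\mathbf{Q}(q)$ with $\tau_{il}\in 1+q\mathbf{Z}_{\ge0}[[q]]$ for all $(i,l)\in I^{\infty}$, and put $\tau_{i0}=1$. **Quantum Borcherds-Bozec algebra.** $\widehat U$ is the associative unital $\mathbf{Q}(q)$-algebra generated by $q^h$ $(h\in P^{\vee})$, $e_{il},f_{il}$ $((i,l)\in I^{\infty})$ with relations: $q^0=1$, $q^hq^{h'}=q^{h+h'}$; $q^he_{jl}q^{-h}=q^{l\langle h,\alpha_j\rangle}e_{jl}$, $q^hf_{jl}q^{-h}=q^{-l\langle h,\alpha_j\rangle}f_{jl}$; for $i\in I^{\mathrm{re}}$, $(j,l)\in I^{\infty}$, $(j,l)\ne(i,1)$: $\sum_{k=0}^{1-la_{ij}}(-1)^k\left[\begin{smallmatrix}1-la_{ij}\\k\end{smallmatrix}\right]_i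 e_i^{1-la_{ij}-k}e_{jl}e_i^k=0$ and the same with $e$ replaced by $f$; $e_{ik}e_{jl}=e_{jl}e_{ik}$ and $f_{ik}f_{jl}=f_{jl}f_{ik}$ whenever $a_{ij}=0$ (including $i=j$ with $a_{ii}=0$). $U_q(\mathfrak g)$ is the quotient of $\widehat U$ by the (Drinfeld-type) relations: $e_{jl}f_{ik}=f_{ik}e_{jl}$ for $i\neq j$, $(i,k),(j,l)\in I^\infty$; and for all $i\in I$ and $(i,k),(i,l)\in I^{\infty}$, $$\sum_{\substack{m+n=k\\ n+s=l}}q_{(i)}^{n(m-s)}\tau_{in}\,e_{is}f_{im}K_i^{-n}=\sum_{\substack{m+n=k\\ n+s=l}}q_{(i)}^{-n(m-s)}\tau_{in}\,f_{im}e_{is}K_i^{n},$$ where $m,n,s\ge0$. **Highest weight modules.** A $U_q(\mathfrak g)$-module $V$ is a highest weight module with highest weight $\lambda\in P$ and highest weight vector $v_\lambda\ne0$ if $q^hv_\lambda=q^{\langle h,\lambda\rangle}v_\lambda$ for all $h\in P^{\vee}$, $e_{il}v_\lambda=0$ for all $(i,l)\in I^{\infty}$, and $V=U_q(\mathfrak g)v_\lambda$. The Verma module is $M(\lambda)=U_q(\mathfrak g)/J(\lambda)$ with $J(\lambda)$ the left ideal generated by $q^h-q^{\langle h,\lambda\rangle}1$ $(h\in P^\vee)$ and all $e_{il}$; it has a unique maximal submodule, and $V(\lambda)$ is the corresponding irreducible quotient. *)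

theory Defs
  imports
    "HOL-Library.Poly_Mapping"
    "HOL-Library.Countable_Set"
    "HOL-Computational_Algebra.Polynomial_Factorial"
    "HOL-Computational_Algebra.Polynomial_FPS"
    "HOL-Algebra.Module"
    "HOL-Algebra.QuotRing"
begin

section \<open>Free abelian groups\<close>

definition int_scale :: "int \<Rightarrow> 'p \<Rightarrow> 'p::ab_group_add" where
  "int_scale n x = (if n \<ge> 0 then ((+) x ^^ nat n) 0 else - (((+) x ^^ nat (- n)) 0))"

lemma funpow_plus_add:
  "((+) (x::'p::ab_group_add) ^^ (m + n)) 0 = ((+) x ^^ m) 0 + ((+) x ^^ n) 0"
  by (induction m) (simp_all add: add.assoc)

lemma int_scale_diff:
  "int_scale (int m - int n) x = ((+) x ^^ m) 0 - ((+) x ^^ n) 0"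
proof (cases "m \<ge> n")
  case True
  then obtain d where "m = d + n" by (metis add.commute le_Suc_ex)
  then show ?thesis by (simp add: int_scale_def funpow_plus_add)
next
  case False
  then obtain d where "n = d + m" "d > 0" by (metis add.commute less_imp_add_positive not_le)
  then show ?thesis by (simp add: int_scale_def funpow_plus_add)
qed

lemma int_scale_add_left: "int_scale (a + b) x = int_scale a x + int_scale b x"
proof -
  obtain m n where a: "a = int m - int n" by (metis int_diff_cases)
  obtain k l where b: "b = int k - int l" by (metis int_diff_cases)
  have "a + b = int (m + k) - int (n + l)" using a b by simp
  then show ?thesis
    unfolding a b by (simp only: int_scale_diff funpow_plus_add) (simp add: algebra_simps)
qed

lemma funpow_plus_distrib:
  "((+) (x + y::'p::ab_group_add) ^^ n) 0 = ((+) x ^^ n) 0 + ((+) y ^^ n) 0"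
  by (induction n) (simp_all add: algebra_simps)

lemma int_scale_add_right: "int_scale a (x + y) = int_scale a x + int_scale a y"
  by (simp add: int_scale_def funpow_plus_distrib)

lemma int_scale_one: "int_scale 1 x = x"
  by (simp add: int_scale_def)

lemma int_scale_mult: "int_scale a (int_scale b x) = int_scale (a * b) x"
proof (induction a rule: int_induct[where k = 0])
  case base
  show ?case by (simp add: int_scale_def)
next
  case (step1 i)
  then show ?case by (simp add: int_scale_add_left int_scale_one distrib_right)
next
  case (step2 i)
  have "int_scale (i - 1 + 1) (int_scale b x)
      = int_scale (i - 1) (int_scale b x) + int_scale b x"
    by (simp only: int_scale_add_left int_scale_one)
  moreover have "int_scale ((i - 1) * b + b) x = int_scale ((i - 1) * b) x + int_scale b x"
    by (simp only: int_scale_add_left)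
  ultimately show ?case using step2 by (simp add: algebra_simps)
qed

interpretation int_module: Modules.module "int_scale :: int \<Rightarrow> 'p \<Rightarrow> 'p::ab_group_add"
  by unfold_locales
    (simp_all add: int_scale_add_left int_scale_add_right int_scale_one int_scale_mult)

definition free_abelian :: "'p::ab_group_add itself \<Rightarrow> bool" where
  "free_abelian _ \<longleftrightarrow>
    (\<exists>B::'p set. int_module.independent B \<and> int_module.span B = UNIV)"

text \<open>The dual \<open>Hom(P, \<int>)\<close>; the pairing \<open>\<langle>h, x\<rangle>\<close> is the application \<open>h x\<close>.\<close>

definition dual_lattice :: "('p::ab_group_add \<Rightarrow> int) set" where
  "dual_lattice = {h. additive h}"


section \<open>Borcherds-Cartan data\<close>

record ('i, 'p) bc_datum =
  idx :: "'i set"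
  cartan :: "'i \<Rightarrow> 'i \<Rightarrow> int"
  symm :: "'i \<Rightarrow> int"
  root :: "'i \<Rightarrow> 'p"
  coroot :: "'i \<Rightarrow> 'p \<Rightarrow> int"

definition even_symmetrizable_bc_matrix ::
    "'i set \<Rightarrow> ('i \<Rightarrow> 'i \<Rightarrow> int) \<Rightarrow> ('i \<Rightarrow> int) \<Rightarrow> bool" where
  "even_symmetrizable_bc_matrix I a s \<longleftrightarrow>
    (\<forall>i\<in>I. a i i \<le> 2 \<and> even (a i i)) \<and>
    (\<forall>i\<in>I. \<forall>j\<in>I. i \<noteq> j \<longrightarrow> a i j \<le> 0) \<and>
    (\<forall>i\<in>I. s i > 0) \<and>
    (\<forall>i\<in>I. \<forall>j\<in>I. s i * a i j = s j * a j i)"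

text \<open>
  The weight lattice is the whole type \<open>'p\<close>. Linear independence of the simple roots
  over \<open>\<rat>\<close> (in \<open>\<rat> \<otimes> P\<close>) is independence of the family over \<open>\<int>\<close>, denominators being cleared;
  injectivity is needed because \<open>independent\<close> speaks about sets.
\<close>

definition borcherds_cartan_datum :: "('i, 'p::ab_group_add) bc_datum \<Rightarrow> bool" where
  "borcherds_cartan_datum D \<longleftrightarrow>
    countable (idx D) \<and>
    even_symmetrizable_bc_matrix (idx D) (cartan D) (symm D) \<and>
    free_abelian TYPE('p) \<and>
    (\<forall>i\<in>idx D. coroot D i \<in> dual_lattice) \<and>
    (\<forall>i\<in>idx D. \<forall>j\<in>idx D. coroot D i (root D j) = cartan D i j) \<and>
    inj_on (root D) (idx D) \<and> int_module.independent (root D ` idx D) \<and>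
    (\<forall>i\<in>idx D. \<exists>\<Lambda>. \<forall>j\<in>idx D. coroot D j \<Lambda> = (if i = j then 1 else 0))"

definition I_re :: "('i, 'p) bc_datum \<Rightarrow> 'i set" where
  "I_re D = {i \<in> idx D. cartan D i i = 2}"

definition I_im :: "('i, 'p) bc_datum \<Rightarrow> 'i set" where
  "I_im D = {i \<in> idx D. cartan D i i \<le> 0}"

definition I_inf :: "('i, 'p) bc_datum \<Rightarrow> ('i \<times> nat) set" where
  "I_inf D = I_re D \<times> {1} \<union> I_im D \<times> {l. l > 0}"

definition dominant_weights :: "('i, 'p) bc_datum \<Rightarrow> 'p set" where
  "dominant_weights D = {x. \<forall>i\<in>idx D. coroot D i x \<ge> 0}"


section \<open>The ground field \<open>\<rat>(q)\<close>\<close>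

type_synonym Qq = "rat poly fract"

definition q :: Qq where
  "q = to_fract [:0, 1:]"

definition q_idx :: "('i, 'p) bc_datum \<Rightarrow> 'i \<Rightarrow> Qq" where
  "q_idx D i = q powi symm D i"

text \<open>\<open>q\<^sub>(\<^sub>i\<^sub>)\<close>; the division is exact since \<open>cartan D i i\<close> is even.\<close>

definition q_par :: "('i, 'p) bc_datum \<Rightarrow> 'i \<Rightarrow> Qq" where
  "q_par D i = q_idx D i powi (cartan D i i div 2)"

definition q_int :: "('i, 'p) bc_datum \<Rightarrow> 'i \<Rightarrow> nat \<Rightarrow> Qq" where
  "q_int D i n =
    (q_idx D i powi int n - q_idx D i powi (- int n)) / (q_idx D i - inverse (q_idx D i))"

definition q_fact :: "('i, 'p) bc_datum \<Rightarrow> 'i \<Rightarrow> nat \<Rightarrow> Qq" where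
  "q_fact D i n = (\<Prod>k=1..n. q_int D i k)"

definition q_binom :: "('i, 'p) bc_datum \<Rightarrow> 'i \<Rightarrow> nat \<Rightarrow> nat \<Rightarrow> Qq" where
  "q_binom D i n k = q_fact D i n / (q_fact D i k * q_fact D i (n - k))"

text \<open>A rational function \<open>p/r\<close> has the power series \<open>F\<close> as its expansion at \<open>q = 0\<close>.\<close>

definition has_q_expansion :: "Qq \<Rightarrow> rat fps \<Rightarrow> bool" where
  "has_q_expansion x F \<longleftrightarrow>
    (\<exists>p r. r \<noteq> 0 \<and> x = to_fract p / to_fract r \<and> fps_of_poly p = F * fps_of_poly r)"

definition admissible_tau :: "('i, 'p) bc_datum \<Rightarrow> ('i \<Rightarrow> nat \<Rightarrow> Qq) \<Rightarrow> bool" where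
  "admissible_tau D \<tau> \<longleftrightarrow>
    (\<forall>i\<in>idx D. \<tau> i 0 = 1) \<and>
    (\<forall>(i, l)\<in>I_inf D. \<exists>F. has_q_expansion (\<tau> i l) F \<and>
       fps_nth F 0 = 1 \<and> (\<forall>n. fps_nth F n \<in> \<nat>))"


section \<open>Free associative algebras\<close>

text \<open>
  Words form the free monoid, written additively so that finitely supported functions on
  words carry the convolution product of \<^theory>\<open>HOL-Library.Poly_Mapping\<close>.
\<close>

datatype 'g free_word = Word (letters: "'g list")

instantiation free_word :: (type) monoid_add
begin

definition zero_free_word :: "'g free_word" where
  "zero_free_word = Word []"

definition plus_free_word :: "'g free_word \<Rightarrow> 'g free_word \<Rightarrow> 'g free_word" where
  "plus_free_word u w = Word (letters u @ letters w)"

instance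
  by standard (simp_all add: zero_free_word_def plus_free_word_def)

end

type_synonym 'g free_alg = "'g free_word \<Rightarrow>\<^sub>0 Qq"

definition scalar :: "Qq \<Rightarrow> 'g free_alg" where
  "scalar c = Poly_Mapping.single 0 c"

definition letter :: "'g \<Rightarrow> 'g free_alg" where
  "letter g = Poly_Mapping.single (Word [g]) 1"

definition free_algebra :: "'g set \<Rightarrow> 'g free_alg ring" where
  "free_algebra G =
    \<lparr>carrier = {p. \<forall>w\<in>Poly_Mapping.keys p. set (letters w) \<subseteq> G},
     mult = (*), one = 1, zero = 0, add = (+)\<rparr>"


section \<open>The quantum Borcherds-Bozec algebra\<close>

datatype ('i, 'p) gen = Q "'p \<Rightarrow> int" | E 'i nat | F 'i nat

type_synonym ('i, 'p) bb_free = "('i, 'p) gen free_alg"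

definition generators :: "('i, 'p::ab_group_add) bc_datum \<Rightarrow> ('i, 'p) gen set" where
  "generators D =
    Q ` dual_lattice \<union> (\<lambda>(i, l). E i l) ` I_inf D \<union> (\<lambda>(i, l). F i l) ` I_inf D"

definition qh :: "('p \<Rightarrow> int) \<Rightarrow> ('i, 'p) bb_free" where
  "qh h = letter (Q h)"

definition ee :: "'i \<Rightarrow> nat \<Rightarrow> ('i, 'p) bb_free" where
  "ee i l = (if l = 0 then 1 else letter (E i l))"

definition ff :: "'i \<Rightarrow> nat \<Rightarrow> ('i, 'p) bb_free" where
  "ff i l = (if l = 0 then 1 else letter (F i l))"

text \<open>\<open>KK D i n\<close> is \<open>K\<^sub>i\<^sup>n = q\<^bsup>n s\<^sub>i h\<^sub>i\<^esup>\<close>.\<close>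

definition KK :: "('i, 'p) bc_datum \<Rightarrow> 'i \<Rightarrow> int \<Rightarrow> ('i, 'p) bb_free" where
  "KK D i n = qh (\<lambda>x. n * symm D i * coroot D i x)"

text \<open>A relation \<open>x = y\<close> is recorded as the element \<open>x - y\<close>.\<close>

definition torus_relations :: "('i, 'p::ab_group_add) bc_datum \<Rightarrow> ('i, 'p) bb_free set" where
  "torus_relations D =
    {qh (\<lambda>x. 0) - 1} \<union>
    {qh h * qh h' - qh (\<lambda>x. h x + h' x) | h h'. h \<in> dual_lattice \<and> h' \<in> dual_lattice} \<union>
    {qh h * ee j l * qh (\<lambda>x. - h x) - scalar (q powi (int l * h (root D j))) * ee j l
      | h j l. h \<in> dual_lattice \<and> (j, l) \<in> I_inf D} \<union>
    {qh h * ff j l * qh (\<lambda>x. - h x) - scalar (q powi (- (int l * h (root D j)))) * ff j l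
      | h j l. h \<in> dual_lattice \<and> (j, l) \<in> I_inf D}"

text \<open>
  In the relevant cases \<open>i \<noteq> j\<close>, hence \<open>1 - l a\<^sub>i\<^sub>j > 0\<close> and the conversion to \<open>nat\<close> is harmless.
\<close>

definition serre :: "('i, 'p) bc_datum \<Rightarrow> ('i \<Rightarrow> nat \<Rightarrow> ('i, 'p) bb_free) \<Rightarrow>
    'i \<Rightarrow> 'i \<Rightarrow> nat \<Rightarrow> ('i, 'p) bb_free" where
  "serre D x i j l =
    (let N = nat (1 - int l * cartan D i j) in
      \<Sum>k=0..N. scalar ((-1) ^ k * q_binom D i N k) * x i 1 ^ (N - k) * x j l * x i 1 ^ k)"

definition serre_relations :: "('i, 'p) bc_datum \<Rightarrow> ('i, 'p) bb_free set" where
  "serre_relations D =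
    {serre D x i j l | x i j l.
      x \<in> {ee, ff} \<and> i \<in> I_re D \<and> (j, l) \<in> I_inf D \<and> (j, l) \<noteq> (i, 1)} \<union>
    {x i k * x j l - x j l * x i k | x i j k l.
      x \<in> {ee, ff} \<and> (i, k) \<in> I_inf D \<and> (j, l) \<in> I_inf D \<and> cartan D i j = 0}"

definition drinfeld_relations ::
    "('i, 'p) bc_datum \<Rightarrow> ('i \<Rightarrow> nat \<Rightarrow> Qq) \<Rightarrow> ('i, 'p) bb_free set" where
  "drinfeld_relations D \<tau> =
    {ee j l * ff i k - ff i k * ee j l | i j k l.
      (i, k) \<in> I_inf D \<and> (j, l) \<in> I_inf D \<and> i \<noteq> j} \<union>
    {(\<Sum>(m, n, s) \<in> {(m, n, s). m + n = k \<and> n + s = l}.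
        scalar (q_par D i powi (int n * (int m - int s)) * \<tau> i n)
          * ee i s * ff i m * KK D i (- int n))
     - (\<Sum>(m, n, s) \<in> {(m, n, s). m + n = k \<and> n + s = l}.
        scalar (q_par D i powi (- (int n * (int m - int s))) * \<tau> i n)
          * ff i m * ee i s * KK D i (int n))
      | i k l. (i, k) \<in> I_inf D \<and> (i, l) \<in> I_inf D}"

definition bb_ideal ::
    "('i, 'p::ab_group_add) bc_datum \<Rightarrow> ('i \<Rightarrow> nat \<Rightarrow> Qq) \<Rightarrow> ('i, 'p) bb_free set" where
  "bb_ideal D \<tau> = genideal (free_algebra (generators D))
     (torus_relations D \<union> serre_relations D \<union> drinfeld_relations D \<tau>)"

definition U_q ::
    "('i, 'p::ab_group_add) bc_datum \<Rightarrow> ('i \<Rightarrow> nat \<Rightarrow> Qq) \<Rightarrow> ('i, 'p) bb_free set ring" where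
  "U_q D \<tau> = free_algebra (generators D) Quot bb_ideal D \<tau>"

definition U_class :: "('i, 'p::ab_group_add) bc_datum \<Rightarrow> ('i \<Rightarrow> nat \<Rightarrow> Qq) \<Rightarrow>
    ('i, 'p) bb_free \<Rightarrow> ('i, 'p) bb_free set" where
  "U_class D \<tau> x = bb_ideal D \<tau> +>\<^bsub>free_algebra (generators D)\<^esub> x"


section \<open>Modules\<close>

text \<open>
  The library's \<^locale>\<open>Module.module\<close> assumes a commutative ring; this is its analogue for
  left modules over an arbitrary ring. Over \<open>U_q\<close>, the scalars act through \<open>\<rat>(q) \<rightarrow> U_q\<close>.
\<close>

locale left_module = R?: ring R + M?: abelian_group M
  for R (structure) and M :: "('a, 'b) module" (structure) +
  assumes smult_closed:
      "\<lbrakk>a \<in> carrier R; x \<in> carrier M\<rbrakk> \<Longrightarrow> a \<odot>\<^bsub>M\<^esub> x \<in> carrier M"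
    and smult_l_distr:
      "\<lbrakk>a \<in> carrier R; b \<in> carrier R; x \<in> carrier M\<rbrakk> \<Longrightarrow>
        (a \<oplus> b) \<odot>\<^bsub>M\<^esub> x = a \<odot>\<^bsub>M\<^esub> x \<oplus>\<^bsub>M\<^esub> b \<odot>\<^bsub>M\<^esub> x"
    and smult_r_distr:
      "\<lbrakk>a \<in> carrier R; x \<in> carrier M; y \<in> carrier M\<rbrakk> \<Longrightarrow>
        a \<odot>\<^bsub>M\<^esub> (x \<oplus>\<^bsub>M\<^esub> y) = a \<odot>\<^bsub>M\<^esub> x \<oplus>\<^bsub>M\<^esub> a \<odot>\<^bsub>M\<^esub> y"
    and smult_assoc:
      "\<lbrakk>a \<in> carrier R; b \<in> carrier R; x \<in> carrier M\<rbrakk> \<Longrightarrow>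
        (a \<otimes> b) \<odot>\<^bsub>M\<^esub> x = a \<odot>\<^bsub>M\<^esub> (b \<odot>\<^bsub>M\<^esub> x)"
    and smult_one:
      "x \<in> carrier M \<Longrightarrow> \<one> \<odot>\<^bsub>M\<^esub> x = x"

definition irreducible_module :: "('a, 'c) ring_scheme \<Rightarrow> ('a, 'b) module \<Rightarrow> bool" where
  "irreducible_module R M \<longleftrightarrow>
    left_module R M \<and> carrier M \<noteq> {\<zero>\<^bsub>M\<^esub>} \<and>
    (\<forall>N. submodule N R M \<longrightarrow> N = {\<zero>\<^bsub>M\<^esub>} \<or> N = carrier M)"

definition highest_weight_module ::
    "('i, 'p::ab_group_add) bc_datum \<Rightarrow> ('i \<Rightarrow> nat \<Rightarrow> Qq) \<Rightarrow>
      (('i, 'p) bb_free set, 'v) module \<Rightarrow> 'p \<Rightarrow> 'v \<Rightarrow> bool" where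
  "highest_weight_module D \<tau> V \<mu> v \<longleftrightarrow>
    left_module (U_q D \<tau>) V \<and> v \<in> carrier V \<and> v \<noteq> \<zero>\<^bsub>V\<^esub> \<and>
    (\<forall>h\<in>dual_lattice. U_class D \<tau> (qh h) \<odot>\<^bsub>V\<^esub> v = U_class D \<tau> (scalar (q powi h \<mu>)) \<odot>\<^bsub>V\<^esub> v) \<and>
    (\<forall>(i, l)\<in>I_inf D. U_class D \<tau> (ee i l) \<odot>\<^bsub>V\<^esub> v = \<zero>\<^bsub>V\<^esub>) \<and>
    carrier V = {u \<odot>\<^bsub>V\<^esub> v | u. u \<in> carrier (U_q D \<tau>)}"

text \<open>
  The irreducible highest weight module \<open>V(\<mu>)\<close> is given up to isomorphism: \<open>V\<close> is any module
  with these properties, in particular the irreducible quotient of the Verma module.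
\<close>

definition irreducible_highest_weight_module ::
    "('i, 'p::ab_group_add) bc_datum \<Rightarrow> ('i \<Rightarrow> nat \<Rightarrow> Qq) \<Rightarrow>
      (('i, 'p) bb_free set, 'v) module \<Rightarrow> 'p \<Rightarrow> 'v \<Rightarrow> bool" where
  "irreducible_highest_weight_module D \<tau> V \<mu> v \<longleftrightarrow>
    highest_weight_module D \<tau> V \<mu> v \<and> irreducible_module (U_q D \<tau>) V"

end

theory Submission
  imports Defs
begin

text \<open>
  Both vanishing statements say that a certain vector \<open>w\<close> of the irreducible module \<open>V\<close> is zero:
  \<open>w = f\<^sub>i\<^bsup>n+1\<^esup> v\<close> with \<open>n = \<langle>h\<^sub>i, \<mu>\<rangle>\<close> for real \<open>i\<close>, and \<open>w = f\<^sub>i\<^sub>k v\<close> for imaginary \<open>i\<close>. In both cases \<open>w\<close>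
  is a weight vector of weight \<open>\<mu> - m \<alpha>\<^sub>i\<close> with \<open>m > 0\<close>, and it is singular, that is, killed by
  every \<open>e\<^sub>j\<^sub>l\<close>.

  A singular vector of such a weight vanishes (\<open>singular_vector_in_J\<close>). By the torus and Drinfeld
  relations, the span of all \<open>f\<^bsub>i\<^sub>1k\<^sub>1\<^esub> \<cdots> f\<^bsub>i\<^sub>rk\<^sub>r\<^esub> w\<close> is a submodule, and all its weights have the form
  \<open>\<mu> - \<beta>\<close> where \<open>\<beta>\<close> has a positive coefficient at \<open>\<alpha>\<^sub>i\<close>. Weight vectors of different weights are
  linearly independent, because \<open>q\<close> is not a root of unity and \<open>Hom(P, \<int>)\<close> separates the points
  of the free group \<open>P\<close>. So the submodule does not contain \<open>v\<close>, and irreducibility makes it zero.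

  That \<open>w\<close> is singular is clear for the \<open>e\<^sub>j\<^sub>l\<close> with \<open>j \<noteq> i\<close>, which commute with the \<open>f\<^sub>i\<^sub>k\<close>. For real
  \<open>i\<close> the \<open>sl\<^sub>2\<close> computation writes \<open>e\<^sub>i f\<^sub>i\<^bsup>n+1\<^esup> v\<close> as \<open>\<tau>\<^sub>i\<^sub>1 f\<^sub>i\<^sup>n v\<close> times the sum of the eigenvalues
  of \<open>K\<^sub>i - K\<^sub>i\<^bsup>-1\<^esup>\<close> on \<open>v, f\<^sub>i v, \<dots>, f\<^sub>i\<^sup>n v\<close>, and these eigenvalues cancel in pairs
  (\<open>ee_ff_power\<close>, \<open>real_vanishing\<close>). For imaginary \<open>i\<close> with \<open>\<langle>h\<^sub>i, \<mu>\<rangle> = 0\<close>, each power of \<open>K\<^sub>i\<close> fixes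
  \<open>v\<close>. In the relation between \<open>e\<^sub>i\<^sub>l\<close> and \<open>f\<^sub>i\<^sub>k\<close> applied to \<open>v\<close>, the terms with some \<open>f\<^sub>i\<^sub>m\<close>, \<open>0 < m < k\<close>,
  vanish by induction on \<open>k\<close>, those in which an \<open>e\<^sub>i\<^sub>s\<close>, \<open>s > 0\<close>, meets \<open>v\<close> directly vanish anyway,
  and the terms without any \<open>e\<close> or \<open>f\<close> cancel; \<open>e\<^sub>i\<^sub>l f\<^sub>i\<^sub>k v = 0\<close> remains (\<open>imaginary_vanishing\<close>).

  Throughout, \<open>V\<close> is replaced by the free algebra modulo the annihilator \<open>J\<close> of \<open>v\<close>: a vector \<open>x v\<close>
  is represented by \<open>x\<close>, it is zero if and only if \<open>x \<in> J\<close>, and irreducibility of \<open>V\<close> becomes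
  maximality of the left ideal \<open>J\<close>. So all computations take place in a ring that is a type.
\<close>


section \<open>Free algebras\<close>

lemma poly_mapping_eq_sum_single:
  "p = (\<Sum>w\<in>Poly_Mapping.keys p. Poly_Mapping.single w (Poly_Mapping.lookup p w))"
proof (rule poly_mapping_eqI)
  fix k
  have "(\<Sum>w\<in>Poly_Mapping.keys p. (Poly_Mapping.lookup p w when w = k))
      = (\<Sum>w\<in>Poly_Mapping.keys p. if w = k then Poly_Mapping.lookup p k else 0)"
    by (rule sum.cong) (auto simp: when_def)
  then show "Poly_Mapping.lookup p k = Poly_Mapping.lookup
      (\<Sum>w\<in>Poly_Mapping.keys p. Poly_Mapping.single w (Poly_Mapping.lookup p w)) k"
    by (simp add: lookup_sum lookup_single in_keys_iff)
qed

lemma free_algebra_simps: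
  "x \<otimes>\<^bsub>free_algebra G\<^esub> y = x * y" "x \<oplus>\<^bsub>free_algebra G\<^esub> y = x + y"
  "\<one>\<^bsub>free_algebra G\<^esub> = 1" "\<zero>\<^bsub>free_algebra G\<^esub> = 0"
  by (simp_all add: free_algebra_def)

lemma free_algebra_zero: "0 \<in> carrier (free_algebra G)"
  by (simp add: free_algebra_def)

lemma free_algebra_single:
  "set (letters w) \<subseteq> G \<Longrightarrow> Poly_Mapping.single w c \<in> carrier (free_algebra G)"
  by (simp add: free_algebra_def)

lemma free_algebra_scalar: "scalar c \<in> carrier (free_algebra G)"
  by (simp add: scalar_def free_algebra_single zero_free_word_def)

lemma free_algebra_letter: "g \<in> G \<Longrightarrow> letter g \<in> carrier (free_algebra G)"
  by (simp add: letter_def free_algebra_single)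

lemma free_algebra_add:
  "\<lbrakk>x \<in> carrier (free_algebra G); y \<in> carrier (free_algebra G)\<rbrakk> \<Longrightarrow> x + y \<in> carrier (free_algebra G)"
  using keys_add[of x y] by (auto simp: free_algebra_def)

lemma free_algebra_uminus: "x \<in> carrier (free_algebra G) \<Longrightarrow> - x \<in> carrier (free_algebra G)"
  by (simp add: free_algebra_def)

lemma free_algebra_diff:
  "\<lbrakk>x \<in> carrier (free_algebra G); y \<in> carrier (free_algebra G)\<rbrakk> \<Longrightarrow> x - y \<in> carrier (free_algebra G)"
  using free_algebra_add[of x G "- y"] by (simp add: free_algebra_uminus)

lemma free_algebra_mult:
  "\<lbrakk>x \<in> carrier (free_algebra G); y \<in> carrier (free_algebra G)\<rbrakk> \<Longrightarrow> x * y \<in> carrier (free_algebra G)"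
  using keys_mult[of x y] by (fastforce simp: free_algebra_def plus_free_word_def)

lemma scalar_0: "scalar 0 = 0"
  and scalar_1: "scalar 1 = 1"
  and scalar_add: "scalar (a + b) = scalar a + scalar b"
  and scalar_uminus: "scalar (- a) = - scalar a"
  and scalar_diff: "scalar (a - b) = scalar a - scalar b"
  and scalar_mult: "scalar (a * b) = scalar a * scalar b"
  by (simp_all add: scalar_def single_add single_uminus single_diff mult_single single_one)

lemma free_algebra_one: "1 \<in> carrier (free_algebra G)"
  using free_algebra_scalar[of 1] by (simp add: scalar_1)

lemma free_algebra_power:
  "x \<in> carrier (free_algebra G) \<Longrightarrow> x ^ n \<in> carrier (free_algebra G)"
  by (induction n) (simp_all add: free_algebra_one free_algebra_mult)

lemma free_algebra_sum:
  "(\<And>t. t \<in> S \<Longrightarrow> f t \<in> carrier (free_algebra G)) \<Longrightarrow> sum f S \<in> carrier (free_algebra G)"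
  by (induction S rule: infinite_finite_induct) (simp_all add: free_algebra_zero free_algebra_add)

lemmas free_algebra_closed = free_algebra_zero free_algebra_one free_algebra_scalar
  free_algebra_letter free_algebra_add free_algebra_uminus free_algebra_diff free_algebra_mult
  free_algebra_power free_algebra_sum

text \<open>The shape of this rule fits proofs that a set is closed under left multiplication.\<close>

lemma free_algebra_induct [consumes 1, case_names scalar add letter]:
  assumes "x \<in> carrier (free_algebra G)"
    and scalar: "\<And>c. P (scalar c)"
    and add: "\<And>x y. \<lbrakk>x \<in> carrier (free_algebra G); y \<in> carrier (free_algebra G); P x; P y\<rbrakk>
      \<Longrightarrow> P (x + y)"
    and letter: "\<And>g x. \<lbrakk>g \<in> G; x \<in> carrier (free_algebra G); P x\<rbrakk> \<Longrightarrow> P (letter g * x)"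
  shows "P x"
proof -
  have single: "P (Poly_Mapping.single (Word gs) c)" if "set gs \<subseteq> G" for gs c
    using that
  proof (induction gs)
    case Nil
    then show ?case
      using scalar[of c] by (simp add: scalar_def zero_free_word_def)
  next
    case (Cons g gs)
    have "Poly_Mapping.single (Word (g # gs)) c = letter g * Poly_Mapping.single (Word gs) c"
      by (simp add: letter_def mult_single plus_free_word_def)
    moreover have "Poly_Mapping.single (Word gs) c \<in> carrier (free_algebra G)"
      using Cons.prems by (intro free_algebra_single) simp
    ultimately show ?case
      using Cons letter by simp
  qed
  have "P (\<Sum>w\<in>W. Poly_Mapping.single w (Poly_Mapping.lookup x w))"
    if "W \<subseteq> Poly_Mapping.keys x" for W
    using finite_subset[OF that finite_keys] that
  proof (induction W rule: finite_induct)
    case empty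
    then show ?case
      using scalar[of 0] by (simp add: scalar_0)
  next
    case (insert w W)
    have G: "set (letters w') \<subseteq> G" if "w' \<in> insert w W" for w'
      using that insert.prems assms(1) by (auto simp: free_algebra_def)
    have "P (Poly_Mapping.single w (Poly_Mapping.lookup x w))"
      using single[of "letters w"] G by simp
    moreover have "(\<Sum>w\<in>W. Poly_Mapping.single w (Poly_Mapping.lookup x w)) \<in> carrier (free_algebra G)"
      using G by (intro free_algebra_sum free_algebra_single) simp
    ultimately show ?case
      using insert G by (auto intro!: add free_algebra_single)
  qed
  from this[OF subset_refl] show ?thesis
    by (simp flip: poly_mapping_eq_sum_single)
qed

lemma scalar_commutes: "scalar c * x = x * scalar c"
proof -
  have "x \<in> carrier (free_algebra UNIV)"
    by (simp add: free_algebra_def)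
  then show ?thesis
  proof (induction rule: free_algebra_induct)
    case (scalar d)
    show ?case
      by (simp add: mult.commute flip: scalar_mult)
  next
    case (add x y)
    then show ?case
      by (simp add: distrib_left distrib_right)
  next
    case (letter g x)
    have "scalar c * letter g = letter g * scalar c"
      by (simp add: scalar_def letter_def mult_single)
    then have "scalar c * (letter g * x) = letter g * (scalar c * x)"
      by (simp add: mult.assoc[symmetric])
    then show ?case
      using letter by (simp add: mult.assoc)
  qed
qed

lemma scalar_left_commute: "x * (scalar c * y) = scalar c * (x * y)"
  using scalar_commutes[of c x] by (simp flip: mult.assoc)

lemma ring_free_algebra: "Ring.ring (free_algebra G)"
proof (rule ringI)
  show "abelian_group (free_algebra G)"
  proof (rule abelian_groupI)
    fix x assume "x \<in> carrier (free_algebra G)"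
    then show "\<exists>y\<in>carrier (free_algebra G). y \<oplus>\<^bsub>free_algebra G\<^esub> x = \<zero>\<^bsub>free_algebra G\<^esub>"
      by (intro bexI[of _ "- x"]) (simp_all add: free_algebra_simps free_algebra_uminus)
  qed (simp_all add: free_algebra_simps free_algebra_closed ac_simps)
  show "Group.monoid (free_algebra G)"
    by (rule monoidI) (simp_all add: free_algebra_simps free_algebra_closed mult.assoc)
qed (simp_all add: free_algebra_simps distrib_left distrib_right)


section \<open>Powers of the indeterminate\<close>

lemma q_nonzero: "q \<noteq> 0"
  by (simp add: q_def)

lemma q_powi_eq_iff: "q powi a = q powi b \<longleftrightarrow> a = b"
proof
  have power: "q ^ n = to_fract (monom 1 n)" for n
    by (induction n) (simp_all add: q_def monom_0 monom_Suc flip: to_fract_mult one_pCons)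
  \<comment> \<open>No positive power of the indeterminate is \<open>1\<close>, by degrees.\<close>
  have pos: "n = 0" if "q powi int n = 1" for n
  proof -
    have "to_fract (monom 1 n) = (to_fract 1 :: Qq)"
      using that by (simp add: power)
    then show "n = 0"
      by (metis to_fract_eq_iff degree_1 degree_monom_eq zero_neq_one)
  qed
  assume eq: "q powi a = q powi b"
  then have "q powi (a - b) = 1" "q powi (b - a) = 1"
    by (simp_all add: power_int_diff q_nonzero)
  then show "a = b"
    using pos[of "nat (a - b)"] pos[of "nat (b - a)"] by (cases "a \<ge> b") auto
qed simp


section \<open>Separating weights\<close>

lemma dual_lattice_add: "h \<in> dual_lattice \<Longrightarrow> h (x + y) = h x + h y"
  by (simp add: dual_lattice_def additive.add)

lemma dual_lattice_diff: "h \<in> dual_lattice \<Longrightarrow> h (x - y) = h x - h y"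
  by (simp add: dual_lattice_def additive.diff)

lemma dual_lattice_int_scale: 
  assumes "h \<in> dual_lattice" shows "h (int_scale n x) = n * h x"
proof (induction n rule: int_induct[where k = 0])
  case base
  show ?case
    using assms by (simp add: dual_lattice_def additive.zero)
next
  case (step1 i)
  then show ?case
    using assms by (simp add: dual_lattice_add algebra_simps)
next
  case (step2 i)
  then show ?case
    using assms by (simp add: int_module.scale_left_diff_distrib dual_lattice_diff algebra_simps)
qed

lemma dual_lattice_lincomb:
  assumes "h \<in> dual_lattice" shows "(\<lambda>x. n * h x) \<in> dual_lattice"
  using assms by (auto simp: dual_lattice_def additive_def algebra_simps)

lemma dual_lattice_plus:
  "h \<in> dual_lattice \<Longrightarrow> h' \<in> dual_lattice \<Longrightarrow> (\<lambda>x. h x + h' x) \<in> dual_lattice"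
  by (auto simp: dual_lattice_def additive_def algebra_simps)

text \<open>A coordinate with respect to a basis of \<open>P\<close> separates \<open>x\<close> from \<open>0\<close>.\<close>

lemma dual_lattice_separates:
  assumes "free_abelian TYPE('p::ab_group_add)" and "(x :: 'p) \<noteq> 0"
  obtains h where "h \<in> dual_lattice" and "h x \<noteq> 0"
proof -
  obtain B :: "'p set" where B: "int_module.independent B" "int_module.span B = UNIV"
    using assms(1) by (auto simp: free_abelian_def)
  have "\<exists>b. int_module.representation B x b \<noteq> 0"
  proof (rule ccontr)
    assume "\<not> ?thesis"
    then show False
      using int_module.sum_nonzero_representation_eq[of B x] B assms(2) by simp
  qed
  moreover have "(\<lambda>y. int_module.representation B y b) \<in> dual_lattice" for b
    using B by (simp add: dual_lattice_def additive_def int_module.representation_add)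
  ultimately show thesis
    using that by blast
qed


section \<open>The algebra as a quotient of the free algebra\<close>

text \<open>The free algebra on the generators \<open>q\<^sup>h\<close>, \<open>e\<^sub>i\<^sub>l\<close>, \<open>f\<^sub>i\<^sub>l\<close>, and the relations imposed on it.\<close>

abbreviation bb_carrier :: "('i, 'p::ab_group_add) bc_datum \<Rightarrow> ('i, 'p) bb_free set" where
  "bb_carrier D \<equiv> carrier (free_algebra (generators D))"

abbreviation bb_relations ::
    "('i, 'p::ab_group_add) bc_datum \<Rightarrow> ('i \<Rightarrow> nat \<Rightarrow> Qq) \<Rightarrow> ('i, 'p) bb_free set" where
  "bb_relations D \<tau> \<equiv> torus_relations D \<union> serre_relations D \<union> drinfeld_relations D \<tau>"

lemma qh_closed: "h \<in> dual_lattice \<Longrightarrow> qh h \<in> bb_carrier D"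
  by (auto simp: qh_def generators_def intro!: free_algebra_letter)

lemma ee_closed: "l = 0 \<or> (i, l) \<in> I_inf D \<Longrightarrow> ee i l \<in> bb_carrier D"
  by (force simp: ee_def generators_def intro!: free_algebra_letter free_algebra_one)

lemma ff_closed: "l = 0 \<or> (i, l) \<in> I_inf D \<Longrightarrow> ff i l \<in> bb_carrier D"
  by (force simp: ff_def generators_def intro!: free_algebra_letter free_algebra_one)

lemma ee_0: "ee i 0 = 1" and ff_0: "ff i 0 = 1"
  by (simp_all add: ee_def ff_def)

lemma I_inf_idx: "(i, l) \<in> I_inf D \<Longrightarrow> i \<in> idx D \<and> l > 0"
  by (auto simp: I_inf_def I_re_def I_im_def)

lemma I_inf_downward: "(i, k) \<in> I_inf D \<Longrightarrow> m \<le> k \<Longrightarrow> m = 0 \<or> (i, m) \<in> I_inf D"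
  by (auto simp: I_inf_def)

lemma I_inf_summand: "(i, a + b) \<in> I_inf D \<Longrightarrow> (i, a) \<notin> I_inf D \<Longrightarrow> a = 0"
  "(i, a + b) \<in> I_inf D \<Longrightarrow> (i, b) \<notin> I_inf D \<Longrightarrow> b = 0"
  by (meson I_inf_downward le_add1 le_add2)+

lemma KK_closed:
  assumes "borcherds_cartan_datum D" "i \<in> idx D"
  shows "KK D i n \<in> bb_carrier D"
proof -
  have "(\<lambda>x. n * symm D i * coroot D i x) \<in> dual_lattice"
    using assms by (intro dual_lattice_lincomb) (auto simp: borcherds_cartan_datum_def)
  then show ?thesis
    by (simp add: KK_def qh_closed)
qed

lemma serre_closed:
  assumes "x \<in> {ee, ff}" "i \<in> I_re D" "(j, l) \<in> I_inf D"
  shows "serre D x i j l \<in> bb_carrier D"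
proof -
  have "(i, 1) \<in> I_inf D"
    using assms(2) by (simp add: I_inf_def)
  then have "x i 1 \<in> bb_carrier D" "x j l \<in> bb_carrier D"
    using assms by (auto intro: ee_closed ff_closed)
  then show ?thesis
    unfolding serre_def Let_def by (intro free_algebra_closed) 
qed

lemma bb_relations_closed:
  assumes "borcherds_cartan_datum D"
  shows "bb_relations D \<tau> \<subseteq> bb_carrier D"
proof -
  have zero: "(\<lambda>x. 0) \<in> dual_lattice"
    by (simp add: dual_lattice_def additive_def)
  have neg: "(\<lambda>x. - h x) \<in> dual_lattice" if "h \<in> dual_lattice" for h :: "'b \<Rightarrow> int"
    using dual_lattice_lincomb[OF that, of "-1"] by simp
  have "torus_relations D \<subseteq> bb_carrier D"
    unfolding torus_relations_def
    by (auto intro!: free_algebra_diff free_algebra_mult free_algebra_one free_algebra_scalar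
        qh_closed ee_closed ff_closed zero neg dual_lattice_plus)
  moreover have "serre_relations D \<subseteq> bb_carrier D"
    unfolding serre_relations_def
    by (auto intro!: free_algebra_diff free_algebra_mult serre_closed ee_closed ff_closed)
  moreover have "drinfeld_relations D \<tau> \<subseteq> bb_carrier D"
    unfolding drinfeld_relations_def
    by (auto intro!: free_algebra_diff free_algebra_mult free_algebra_sum free_algebra_scalar
        ee_closed ff_closed KK_closed assms dest: I_inf_idx I_inf_summand)
  ultimately show ?thesis
    by blast
qed

lemma ideal_bb_ideal:
  assumes "borcherds_cartan_datum D"
  shows "ideal (bb_ideal D \<tau>) (free_algebra (generators D))"
  unfolding bb_ideal_def
  by (rule ring.genideal_ideal[OF ring_free_algebra bb_relations_closed[OF assms]])

lemma U_class_hom: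
  assumes "borcherds_cartan_datum D"
  shows "ring_hom_ring (free_algebra (generators D)) (U_q D \<tau>) (U_class D \<tau>)"
  using ideal.rcos_ring_hom_ring[OF ideal_bb_ideal[OF assms]]
  by (simp add: U_q_def U_class_def[abs_def])

lemma U_class_relation:
  assumes "borcherds_cartan_datum D" "r \<in> bb_relations D \<tau>"
  shows "U_class D \<tau> r = \<zero>\<^bsub>U_q D \<tau>\<^esub>"
proof -
  interpret ideal "bb_ideal D \<tau>" "free_algebra (generators D)"
    by (rule ideal_bb_ideal[OF assms(1)])
  have "r \<in> bb_ideal D \<tau>"
    using genideal_self[OF bb_relations_closed[OF assms(1)]] assms(2) by (auto simp: bb_ideal_def)
  then show ?thesis
    by (simp add: U_class_def U_q_def FactRing_def a_rcos_const)
qed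

lemma U_q_carrierE:
  assumes "a \<in> carrier (U_q D \<tau>)"
  obtains x where "x \<in> bb_carrier D" "a = U_class D \<tau> x"
  using assms by (auto simp: U_q_def U_class_def FactRing_def A_RCOSETS_def')


section \<open>Annihilators of highest weight vectors\<close>

lemma left_module_zero_smult:
  assumes "left_module R M" "x \<in> carrier M"
  shows "\<zero>\<^bsub>R\<^esub> \<odot>\<^bsub>M\<^esub> x = \<zero>\<^bsub>M\<^esub>"
proof -
  interpret left_module R M by fact
  have "\<zero>\<^bsub>R\<^esub> \<odot>\<^bsub>M\<^esub> x \<oplus>\<^bsub>M\<^esub> \<zero>\<^bsub>R\<^esub> \<odot>\<^bsub>M\<^esub> x = \<zero>\<^bsub>R\<^esub> \<odot>\<^bsub>M\<^esub> x"
    using assms(2) smult_l_distr[of "\<zero>\<^bsub>R\<^esub>" "\<zero>\<^bsub>R\<^esub>" x] smult_closed by simp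
  then show ?thesis
    using assms(2) smult_closed by simp
qed

lemma left_module_smult_zero:
  assumes "left_module R M" "a \<in> carrier R"
  shows "a \<odot>\<^bsub>M\<^esub> \<zero>\<^bsub>M\<^esub> = \<zero>\<^bsub>M\<^esub>"
proof -
  interpret left_module R M by fact
  have "a \<odot>\<^bsub>M\<^esub> \<zero>\<^bsub>M\<^esub> \<oplus>\<^bsub>M\<^esub> a \<odot>\<^bsub>M\<^esub> \<zero>\<^bsub>M\<^esub> = a \<odot>\<^bsub>M\<^esub> \<zero>\<^bsub>M\<^esub>"
    using assms(2) smult_r_distr[of a "\<zero>\<^bsub>M\<^esub>" "\<zero>\<^bsub>M\<^esub>"] smult_closed by simp
  then show ?thesis
    using assms(2) smult_closed by simp
qed

text \<open>
  The properties of the annihilator \<open>J\<close> of a highest weight vector in an irreducible module. The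
  element \<open>1\<close> represents the highest weight vector; \<open>J\<close> is a maximal left ideal, and the defining
  relations act by zero on every vector.
\<close>

locale highest_weight_ideal =
  fixes D :: "('i, 'p::ab_group_add) bc_datum" and \<tau> :: "'i \<Rightarrow> nat \<Rightarrow> Qq" and \<mu> :: 'p
    and J :: "('i, 'p) bb_free set"
  assumes datum: "borcherds_cartan_datum D"
    and tau_0: "\<And>i. i \<in> idx D \<Longrightarrow> \<tau> i 0 = 1"
    and J_subset: "J \<subseteq> bb_carrier D"
    and J_add: "\<And>x y. \<lbrakk>x \<in> J; y \<in> J\<rbrakk> \<Longrightarrow> x + y \<in> J"
    and J_mult: "\<And>x y. \<lbrakk>x \<in> bb_carrier D; y \<in> J\<rbrakk> \<Longrightarrow> x * y \<in> J"
    and J_relation: "\<And>r x. \<lbrakk>r \<in> bb_relations D \<tau>; x \<in> bb_carrier D\<rbrakk> \<Longrightarrow> r * x \<in> J"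
    and J_weight: "\<And>h. h \<in> dual_lattice \<Longrightarrow> qh h - scalar (q powi h \<mu>) \<in> J"
    and J_ee: "\<And>i l. (i, l) \<in> I_inf D \<Longrightarrow> ee i l \<in> J"
    and one_notin_J: "1 \<notin> J"
    and J_maximal: "\<And>N. \<lbrakk>J \<subseteq> N; N \<subseteq> bb_carrier D; \<And>x y. \<lbrakk>x \<in> N; y \<in> N\<rbrakk> \<Longrightarrow> x + y \<in> N;
        \<And>x y. \<lbrakk>x \<in> bb_carrier D; y \<in> N\<rbrakk> \<Longrightarrow> x * y \<in> N; 1 \<notin> N\<rbrakk> \<Longrightarrow> N \<subseteq> J"

text \<open>
  Maximality comes from irreducibility: a left ideal containing the annihilator of \<open>v\<close> has as its
  image in \<open>V\<close> a submodule, which is all of \<open>V\<close> only if the left ideal contains \<open>1\<close>.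
\<close>

lemma annihilator_highest_weight_ideal:
  fixes D :: "('i, 'p::ab_group_add) bc_datum" and V :: "(('i, 'p) bb_free set, 'v) module"
  assumes datum: "borcherds_cartan_datum D" and tau: "admissible_tau D \<tau>"
    and V: "irreducible_highest_weight_module D \<tau> V \<mu> v"
  shows "highest_weight_ideal D \<tau> \<mu> {x \<in> bb_carrier D. U_class D \<tau> x \<odot>\<^bsub>V\<^esub> v = \<zero>\<^bsub>V\<^esub>}"
    (is "highest_weight_ideal D \<tau> \<mu> ?J")
proof -
  define act where "act x = U_class D \<tau> x \<odot>\<^bsub>V\<^esub> v" for x
  have hw: "highest_weight_module D \<tau> V \<mu> v" and irr: "irreducible_module (U_q D \<tau>) V"
    using V by (simp_all add: irreducible_highest_weight_module_def)
  have V_module: "left_module (U_q D \<tau>) V" and v: "v \<in> carrier V" "v \<noteq> \<zero>\<^bsub>V\<^esub>"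
    using hw unfolding highest_weight_module_def by blast+
  interpret V: left_module "U_q D \<tau>" V by (rule V_module)
  interpret U: ring_hom_ring "free_algebra (generators D)" "U_q D \<tau>" "U_class D \<tau>"
    by (rule U_class_hom[OF datum])
  have act_closed: "act x \<in> carrier V" if "x \<in> bb_carrier D" for x
    using that v by (simp add: act_def V.smult_closed)
  have act_add: "act (x + y) = act x \<oplus>\<^bsub>V\<^esub> act y" if "x \<in> bb_carrier D" "y \<in> bb_carrier D" for x y
    using that v U.hom_add[of x y] by (simp add: act_def V.smult_l_distr free_algebra_simps)
  have act_mult: "act (x * y) = U_class D \<tau> x \<odot>\<^bsub>V\<^esub> act y"
    if "x \<in> bb_carrier D" "y \<in> bb_carrier D" for x y
    using that v U.hom_mult[of x y] by (simp add: act_def V.smult_assoc free_algebra_simps)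
  have act_diff: "act (x - y) = \<zero>\<^bsub>V\<^esub>"
    if "x \<in> bb_carrier D" "y \<in> bb_carrier D" "act x = act y" for x y
  proof -
    have "act (x - y) \<oplus>\<^bsub>V\<^esub> act y = \<zero>\<^bsub>V\<^esub> \<oplus>\<^bsub>V\<^esub> act y"
      using that act_add[of "x - y" y] by (simp add: free_algebra_diff act_closed)
    then show ?thesis
      using that by (simp add: act_closed free_algebra_diff del: V.M.l_zero)
  qed
  have J_iff: "x \<in> ?J \<longleftrightarrow> x \<in> bb_carrier D \<and> act x = \<zero>\<^bsub>V\<^esub>" for x
    by (simp add: act_def)
  have act_one: "act 1 = v"
    using v U.hom_one by (simp add: act_def free_algebra_simps V.smult_one)
  show ?thesis
  proof
    show "borcherds_cartan_datum D" by (rule datum)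
    show "\<tau> i 0 = 1" if "i \<in> idx D" for i
      using that tau by (simp add: admissible_tau_def)
    show "?J \<subseteq> bb_carrier D" by blast
    show "x + y \<in> ?J" if "x \<in> ?J" "y \<in> ?J" for x y
      using that unfolding J_iff by (simp add: act_add free_algebra_add)
    show "x * y \<in> ?J" if "x \<in> bb_carrier D" "y \<in> ?J" for x y
      using that unfolding J_iff
      by (simp add: act_mult free_algebra_mult left_module_smult_zero[OF V_module])
    show "r * x \<in> ?J" if "r \<in> bb_relations D \<tau>" "x \<in> bb_carrier D" for r x
    proof -
      have "r \<in> bb_carrier D"
        using that bb_relations_closed[OF datum] by blast
      then show ?thesis
        using that unfolding J_iff
        by (simp add: act_mult free_algebra_mult U_class_relation[OF datum that(1)]
            left_module_zero_smult[OF V_module] act_closed)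
    qed
    show "qh h - scalar (q powi h \<mu>) \<in> ?J" if "h \<in> dual_lattice" for h
    proof -
      have "act (qh h) = act (scalar (q powi h \<mu>))"
        using hw that by (simp add: highest_weight_module_def act_def)
      then show ?thesis
        using that unfolding J_iff
        by (simp add: act_diff qh_closed free_algebra_scalar free_algebra_diff)
    qed
    show "ee i l \<in> ?J" if "(i, l) \<in> I_inf D" for i l
      using hw that by (auto simp: highest_weight_module_def ee_closed)
    show "1 \<notin> ?J"
      using v act_one unfolding J_iff by simp
    show "N \<subseteq> ?J"
      if J_N: "?J \<subseteq> N" and N_A: "N \<subseteq> bb_carrier D"
        and N_add: "\<And>x y. \<lbrakk>x \<in> N; y \<in> N\<rbrakk> \<Longrightarrow> x + y \<in> N"
        and N_mult: "\<And>x y. \<lbrakk>x \<in> bb_carrier D; y \<in> N\<rbrakk> \<Longrightarrow> x * y \<in> N" and "1 \<notin> N" for N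
    proof -
      have N_uminus: "- x \<in> N" if "x \<in> N" for x
        using N_mult[OF free_algebra_uminus[OF free_algebra_one] that] by simp
      have N_zero: "0 \<in> N"
        using J_N act_diff[of 0 0] by (auto simp: free_algebra_zero act_def)
      have "submodule (act ` N) (U_q D \<tau>) V"
      proof (intro submodule.intro subgroup.intro submodule_axioms.intro)
        show "act ` N \<subseteq> carrier (add_monoid V)"
          using N_A act_closed by auto
        show "x \<otimes>\<^bsub>add_monoid V\<^esub> y \<in> act ` N" if "x \<in> act ` N" "y \<in> act ` N" for x y
          using that N_add N_A by (auto simp: act_add[symmetric] subset_iff)
        have "\<zero>\<^bsub>V\<^esub> = act 0"
          using act_diff[of 0 0] by (simp add: free_algebra_zero)
        then show "\<one>\<^bsub>add_monoid V\<^esub> \<in> act ` N"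
          using N_zero by simp
        show "inv\<^bsub>add_monoid V\<^esub> x \<in> act ` N" if x: "x \<in> act ` N" for x
        proof -
          obtain n where n: "n \<in> N" "x = act n"
            using x by blast
          have "act (- n) \<oplus>\<^bsub>V\<^esub> act n = \<zero>\<^bsub>V\<^esub>"
            using n N_A act_add[of "- n" n] \<open>\<zero>\<^bsub>V\<^esub> = act 0\<close> by (auto simp: free_algebra_uminus)
          then have "inv\<^bsub>add_monoid V\<^esub> x = act (- n)"
            unfolding a_inv_def[symmetric] using n N_A by (intro V.M.add.inv_equality) (auto simp: act_closed free_algebra_uminus)
          then show ?thesis
            using n N_uminus by auto
        qed
        show "a \<odot>\<^bsub>V\<^esub> x \<in> act ` N" if a: "a \<in> carrier (U_q D \<tau>)" and x: "x \<in> act ` N" for a x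
        proof -
          obtain y where "y \<in> bb_carrier D" "a = U_class D \<tau> y"
            using U_q_carrierE[OF a] by blast
          then show ?thesis
            using x N_mult N_A by (auto simp: act_mult[symmetric] subset_iff)
        qed
      qed
      moreover have "act ` N \<noteq> carrier V"
      proof
        assume "act ` N = carrier V"
        then obtain n where n: "n \<in> N" "act n = act 1"
          using v act_one by (metis imageE)
        then have "1 - n \<in> ?J"
          using N_A act_diff[of 1 n] unfolding J_iff
          by (auto simp: free_algebra_one free_algebra_diff)
        then have "(1 - n) + n \<in> N"
          using J_N n N_add by blast
        then show False
          using \<open>1 \<notin> N\<close> by simp
      qed
      ultimately have "act ` N = {\<zero>\<^bsub>V\<^esub>}"
        using irr by (auto simp: irreducible_module_def)
      then show ?thesis
        using N_A unfolding subset_iff J_iff by blast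
    qed
  qed
qed


section \<open>Weight vectors modulo the annihilator\<close>

context highest_weight_ideal
begin

lemma J_carrier: "x \<in> J \<Longrightarrow> x \<in> bb_carrier D"
  using J_subset by blast

lemma J_zero: "0 \<in> J"
  using J_relation[of "qh (\<lambda>x. 0) - 1" 0] by (simp add: torus_relations_def free_algebra_zero)

lemma J_uminus: "x \<in> J \<Longrightarrow> - x \<in> J"
  using J_mult[OF free_algebra_uminus[OF free_algebra_one]] by simp

lemma J_diff: "x \<in> J \<Longrightarrow> y \<in> J \<Longrightarrow> x - y \<in> J"
  using J_add[of x "- y"] J_uminus by simp

lemma J_congI: "x - y \<in> J \<Longrightarrow> y \<in> J \<Longrightarrow> x \<in> J"
  using J_add[of "x - y" y] by simp

lemma J_cong: "x - y \<in> J \<Longrightarrow> x \<in> J \<longleftrightarrow> y \<in> J"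
  using J_congI[of x y] J_diff[of x "x - y"] by force

text \<open>Modulo \<open>J\<close>, the element \<open>x\<close> is a vector of weight \<open>\<nu>\<close> of the module.\<close>

definition has_weight :: "'p \<Rightarrow> ('i, 'p) bb_free \<Rightarrow> bool" where
  "has_weight \<nu> x \<longleftrightarrow>
    x \<in> bb_carrier D \<and> (\<forall>h\<in>dual_lattice. qh h * x - scalar (q powi h \<nu>) * x \<in> J)"

lemma has_weight_carrier: "has_weight \<nu> x \<Longrightarrow> x \<in> bb_carrier D"
  by (simp add: has_weight_def)

lemma has_weightD:
  "has_weight \<nu> x \<Longrightarrow> h \<in> dual_lattice \<Longrightarrow> qh h * x - scalar (q powi h \<nu>) * x \<in> J"
  by (simp add: has_weight_def)

lemma has_weight_one: "has_weight \<mu> 1"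
  by (simp add: has_weight_def free_algebra_one J_weight)

lemma has_weight_scalar:
  assumes "has_weight \<nu> x" shows "has_weight \<nu> (scalar c * x)"
proof -
  have "qh h * (scalar c * x) - scalar (q powi h \<nu>) * (scalar c * x) \<in> J" if "h \<in> dual_lattice" for h
  proof -
    have "scalar c * (qh h * x - scalar (q powi h \<nu>) * x) \<in> J"
      by (intro J_mult free_algebra_scalar has_weightD assms that)
    then show ?thesis
      by (simp add: right_diff_distrib scalar_left_commute[of "qh h" c]
          scalar_left_commute[of "scalar (q powi h \<nu>)" c])
  qed
  then show ?thesis
    using assms by (simp add: has_weight_def free_algebra_closed)
qed

lemma has_weight_cong:
  assumes "has_weight \<nu> x" "x - y \<in> J" "y \<in> bb_carrier D"
  shows "has_weight \<nu> y"
proof -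
  have "qh h * y - scalar (q powi h \<nu>) * y \<in> J" if "h \<in> dual_lattice" for h
  proof -
    have "(qh h - scalar (q powi h \<nu>)) * (x - y) \<in> J"
      using that assms by (intro J_mult) (simp_all add: free_algebra_closed qh_closed)
    then have "(qh h * x - scalar (q powi h \<nu>) * x) - (qh h - scalar (q powi h \<nu>)) * (x - y) \<in> J"
      by (intro J_diff has_weightD assms that)
    then show ?thesis
      by (simp add: algebra_simps)
  qed
  then show ?thesis
    using assms by (simp add: has_weight_def)
qed

lemma qh_ff_commute:
  assumes h: "h \<in> dual_lattice" and jl: "(j, l) \<in> I_inf D" and x: "x \<in> bb_carrier D"
  shows "qh h * (ff j l * x) - scalar (q powi (- (int l * h (root D j)))) * (ff j l * (qh h * x)) \<in> J"
proof -
  let ?h' = "\<lambda>x. - h x" and ?s = "scalar (q powi (- (int l * h (root D j))))"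
  have h': "?h' \<in> dual_lattice"
    using dual_lattice_lincomb[OF h, of "-1"] by simp
  have "qh ?h' * qh h - qh (\<lambda>x. ?h' x + h x) \<in> bb_relations D \<tau>"
    using h h' unfolding torus_relations_def by blast
  then have "(qh ?h' * qh h - qh (\<lambda>x. ?h' x + h x)) * x \<in> J"
    by (intro J_relation x)
  moreover have "(qh (\<lambda>x. 0) - 1) * x \<in> J"
    using x by (intro J_relation) (auto simp: torus_relations_def)
  ultimately have "(qh ?h' * qh h - 1) * x \<in> J"
    using J_add by (fastforce simp: algebra_simps)
  then have "(qh h * ff j l) * ((qh ?h' * qh h - 1) * x) \<in> J"
    using h jl by (intro J_mult[OF free_algebra_mult[OF qh_closed ff_closed]]) auto
  moreover have "(qh h * ff j l * qh ?h' - ?s * ff j l) * (qh h * x) \<in> J"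
    using h jl x by (intro J_relation free_algebra_mult qh_closed)
      (auto simp: torus_relations_def)
  ultimately have "(qh h * ff j l * qh ?h' - ?s * ff j l) * (qh h * x)
      - (qh h * ff j l) * ((qh ?h' * qh h - 1) * x) \<in> J"
    by (rule J_diff[rotated])
  then show ?thesis
    by (simp add: algebra_simps)
qed

lemma has_weight_ff:
  assumes x: "has_weight \<nu> x" and il: "(i, l) \<in> I_inf D"
  shows "has_weight (\<nu> - int_scale (int l) (root D i)) (ff i l * x)"
proof -
  have A: "x \<in> bb_carrier D" "ff i l \<in> bb_carrier D"
    using x il by (simp_all add: has_weight_carrier ff_closed)
  have "qh h * (ff i l * x) - scalar (q powi h (\<nu> - int_scale (int l) (root D i))) * (ff i l * x) \<in> J"
    if h: "h \<in> dual_lattice" for h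
  proof -
    let ?s = "q powi (- (int l * h (root D i)))"
    have s: "q powi h (\<nu> - int_scale (int l) (root D i)) = ?s * q powi h \<nu>"
      using h by (simp add: dual_lattice_diff dual_lattice_int_scale q_nonzero flip: power_int_add)
    have "(scalar ?s * ff i l) * (qh h * x - scalar (q powi h \<nu>) * x) \<in> J"
      using A by (intro J_mult has_weightD x h free_algebra_closed)
    from J_add[OF qh_ff_commute[OF h il A(1)] this] show ?thesis
      by (simp add: s scalar_mult scalar_left_commute[of "ff i l"] right_diff_distrib mult.assoc)
  qed
  then show ?thesis
    using A by (simp add: has_weight_def free_algebra_mult)
qed

lemma has_weight_KK:
  assumes "has_weight \<nu> x" "i \<in> idx D"
  shows "KK D i n * x - scalar (q powi (n * symm D i * coroot D i \<nu>)) * x \<in> J"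
proof -
  have "(\<lambda>x. n * symm D i * coroot D i x) \<in> dual_lattice"
    using assms datum by (intro dual_lattice_lincomb) (auto simp: borcherds_cartan_datum_def)
  from has_weightD[OF assms(1) this] show ?thesis
    by (simp add: KK_def)
qed

text \<open>Sums, modulo \<open>J\<close>, of \<open>n\<close> weight vectors (possibly zero) with weights in \<open>M\<close>.\<close>

primrec weight_sums :: "'p set \<Rightarrow> nat \<Rightarrow> ('i, 'p) bb_free set" where
  "weight_sums M 0 = J"
| "weight_sums M (Suc n) = {g + y | g y \<nu>. has_weight \<nu> g \<and> \<nu> \<in> M \<and> y \<in> weight_sums M n}"

lemma weight_sums_SucI:
  "has_weight \<nu> g \<Longrightarrow> \<nu> \<in> M \<Longrightarrow> y \<in> weight_sums M n \<Longrightarrow> g + y \<in> weight_sums M (Suc n)"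
  by auto

lemma weight_sums_carrier: "x \<in> weight_sums M n \<Longrightarrow> x \<in> bb_carrier D"
  by (induction n arbitrary: x) (auto simp: J_carrier has_weight_carrier free_algebra_add)

lemma weight_sums_add_J: "x \<in> weight_sums M n \<Longrightarrow> j \<in> J \<Longrightarrow> j + x \<in> weight_sums M n"
proof (induction n arbitrary: x)
  case 0
  then show ?case by (simp add: J_add)
next
  case (Suc n)
  then obtain g y \<nu> where "x = g + y" "has_weight \<nu> g" "\<nu> \<in> M" "y \<in> weight_sums M n"
    by auto
  moreover from this have "j + x = g + (j + y)"
    by (simp add: algebra_simps)
  moreover have "j + y \<in> weight_sums M n"
    by (rule Suc.IH) fact+
  ultimately show ?case
    by (simp only: weight_sums_SucI)
qed

lemma weight_sums_add:
  "x \<in> weight_sums M m \<Longrightarrow> y \<in> weight_sums M n \<Longrightarrow> x + y \<in> weight_sums M (m + n)"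
proof (induction m arbitrary: x)
  case 0
  then show ?case by (simp add: weight_sums_add_J)
next
  case (Suc m)
  then obtain g x' \<nu> where "x = g + x'" "has_weight \<nu> g" "\<nu> \<in> M" "x' \<in> weight_sums M m"
    by auto
  then show ?case
    using Suc.IH[OF _ Suc.prems(2)] by (simp only: add.assoc add_Suc weight_sums_SucI)
qed

lemma weight_sums_torus:
  assumes "h \<in> dual_lattice"
  shows "x \<in> weight_sums M n \<Longrightarrow> (qh h - scalar c) * x \<in> weight_sums M n"
proof (induction n arbitrary: x)
  case 0
  then show ?case
    unfolding weight_sums.simps
    by (intro J_mult free_algebra_diff free_algebra_scalar qh_closed assms)
next
  case (Suc n)
  then obtain g y \<nu> where x: "x = g + y" and g: "has_weight \<nu> g" "\<nu> \<in> M"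
    and y: "y \<in> weight_sums M n"
    by auto
  have "scalar (q powi h \<nu> - c) * g - (qh h - scalar c) * g
      = - (qh h * g - scalar (q powi h \<nu>) * g)"
    by (simp add: scalar_diff left_diff_distrib)
  then have "scalar (q powi h \<nu> - c) * g - (qh h - scalar c) * g \<in> J"
    using J_uminus[OF has_weightD[OF g(1) assms]] by (simp only:)
  then have "has_weight \<nu> ((qh h - scalar c) * g)"
    by (rule has_weight_cong[OF has_weight_scalar[OF g(1)]])
      (intro free_algebra_mult free_algebra_diff free_algebra_scalar qh_closed assms
        has_weight_carrier[OF g(1)])
  then show ?case
    unfolding x distrib_left by (rule weight_sums_SucI[OF _ g(2) Suc.IH[OF y]])
qed

text \<open>
  Vectors of different weights are linearly independent: a vector of a weight outside \<open>M\<close> that is a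
  sum of vectors with weights in \<open>M\<close> is zero.
\<close>

lemma weight_sums_independent:
  assumes "\<nu> \<notin> M"
  shows "x \<in> weight_sums M n \<Longrightarrow> has_weight \<nu> x \<Longrightarrow> x \<in> J"
proof (induction n arbitrary: x)
  case 0
  then show ?case by simp
next
  case (Suc n)
  from Suc.prems(1) obtain g y \<kappa> where x: "x = g + y" and g: "has_weight \<kappa> g" "\<kappa> \<in> M"
    and y: "y \<in> weight_sums M n"
    by auto
  have "\<nu> - \<kappa> \<noteq> 0"
    using g(2) assms by auto
  then obtain h where h: "h \<in> dual_lattice" "h (\<nu> - \<kappa>) \<noteq> 0"
    using dual_lattice_separates datum unfolding borcherds_cartan_datum_def by blast
  define d where "d = q powi h \<nu> - q powi h \<kappa>"
  define t :: "('i, 'p) bb_free" where "t = qh h - scalar (q powi h \<kappa>)"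
  have d: "d \<noteq> 0"
    using h by (simp add: d_def q_powi_eq_iff dual_lattice_diff)
  \<comment> \<open>The operator \<open>t\<close> kills \<open>g\<close> and acts on \<open>x\<close> by the nonzero scalar \<open>d\<close>.\<close>
  have "(qh h * g - scalar (q powi h \<kappa>) * g) - (qh h * x - scalar (q powi h \<nu>) * x) \<in> J"
    by (intro J_diff has_weightD g Suc.prems h)
  then have cong: "scalar d * x - t * y \<in> J"
    by (simp add: x t_def d_def scalar_diff algebra_simps)
  have ty: "t * y \<in> weight_sums M n"
    unfolding t_def by (intro weight_sums_torus h y)
  then have "has_weight \<nu> (t * y)"
    using has_weight_cong[OF has_weight_scalar[OF Suc.prems(2)] cong] weight_sums_carrier by blast
  then have "scalar d * x \<in> J"
    using Suc.IH[OF ty] J_cong[OF cong] by simp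
  from J_mult[OF free_algebra_scalar this, of "inverse d"] show ?case
    using d by (simp add: scalar_1 flip: mult.assoc scalar_mult)
qed


section \<open>Commuting raising operators past lowering operators\<close>

lemma ee_ff_commute:
  assumes "(i, k) \<in> I_inf D" "(j, l) \<in> I_inf D" "i \<noteq> j" "x \<in> bb_carrier D"
  shows "ee j l * (ff i k * x) - ff i k * (ee j l * x) \<in> J"
proof -
  have "ee j l * ff i k - ff i k * ee j l \<in> bb_relations D \<tau>"
    using assms unfolding drinfeld_relations_def by blast
  from J_relation[OF this assms(4)] show ?thesis
    by (simp add: algebra_simps)
qed

text \<open>
  The contribution of the triple \<open>(m, n, s)\<close> to the relation between \<open>e\<^sub>i\<^sub>l\<close> and \<open>f\<^sub>i\<^sub>k\<close>, applied to a
  vector \<open>x\<close> of weight \<open>\<nu>\<close>; the powers of \<open>K\<^sub>i\<close> have become scalars.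
\<close>

definition drinfeld_term ::
    "'i \<Rightarrow> 'p \<Rightarrow> ('i, 'p) bb_free \<Rightarrow> nat \<Rightarrow> nat \<Rightarrow> nat \<Rightarrow> ('i, 'p) bb_free" where
  "drinfeld_term i \<nu> x m n s =
    scalar (q_par D i powi (int n * (int m - int s)) * \<tau> i n
        * q powi (- int n * symm D i * coroot D i \<nu>)) * (ee i s * (ff i m * x))
    - scalar (q_par D i powi (- (int n * (int m - int s))) * \<tau> i n
        * q powi (int n * symm D i * coroot D i \<nu>)) * (ff i m * (ee i s * x))"

lemma KK_to_scalar:
  assumes "has_weight \<nu> x" "i \<in> idx D" "y \<in> bb_carrier D" "z \<in> bb_carrier D"
  shows "(scalar a * y * z * KK D i n) * x
    - scalar (a * q powi (n * symm D i * coroot D i \<nu>)) * (y * (z * x)) \<in> J"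
proof -
  let ?c = "q powi (n * symm D i * coroot D i \<nu>)"
  have "(scalar a * y * z) * (KK D i n * x - scalar ?c * x) \<in> J"
    using assms by (intro J_mult has_weight_KK free_algebra_closed)
  then show ?thesis
    by (simp add: right_diff_distrib mult.assoc scalar_mult scalar_left_commute[of y] scalar_left_commute[of z])
qed

lemma finite_drinfeld_indices: "finite {(m::nat, n::nat, s::nat). m + n = k \<and> n + s = l}"
  by (rule finite_subset[of _ "{..k} \<times> {..k} \<times> {..l}"]) auto

lemma sum_drinfeld_term:
  assumes x: "has_weight \<nu> x" and ik: "(i, k) \<in> I_inf D" and il: "(i, l) \<in> I_inf D"
  shows "(\<Sum>(m, n, s) \<in> {(m, n, s). m + n = k \<and> n + s = l}. drinfeld_term i \<nu> x m n s) \<in> J"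
    (is "sum ?T ?S \<in> J")
proof -
  let ?L = "\<lambda>(m, n, s). scalar (q_par D i powi (int n * (int m - int s)) * \<tau> i n)
          * ee i s * ff i m * KK D i (- int n)"
  let ?R = "\<lambda>(m, n, s). scalar (q_par D i powi (- (int n * (int m - int s))) * \<tau> i n)
          * ff i m * ee i s * KK D i (int n)"
  have "sum ?L ?S - sum ?R ?S \<in> bb_relations D \<tau>"
    unfolding drinfeld_relations_def
    by (rule UnI2, rule UnI2, rule CollectI, rule exI[of _ i], rule exI[of _ k], rule exI[of _ l])
      (intro conjI refl ik il)
  then have rel: "(sum ?L ?S - sum ?R ?S) * x \<in> J"
    by (intro J_relation has_weight_carrier[OF x])
  have i: "i \<in> idx D"
    using I_inf_idx[OF ik] by simp
  have summand: "?L t * x - ?R t * x - ?T t \<in> J" if "t \<in> ?S" for t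
  proof -
    obtain m n s where t: "t = (m, n, s)"
      by (cases t)
    then have "m + n = k" "n + s = l"
      using that by simp_all
    then have A: "ee i s \<in> bb_carrier D" "ff i m \<in> bb_carrier D"
      using ik il by (auto intro!: ee_closed ff_closed dest: I_inf_summand)
    have swap: "a - b - (c - d) = (a - c) - (b - d)" for a b c d :: "('i, 'p) bb_free"
      by simp
    show ?thesis
      unfolding t prod.case drinfeld_term_def
      by (subst swap, rule J_diff)
        (rule KK_to_scalar[OF x i A(1,2)] KK_to_scalar[OF x i A(2,1)])+
  qed
  have "(\<Sum>t\<in>S. ?L t * x - ?R t * x - ?T t) \<in> J" if "S \<subseteq> ?S" for S
    using finite_subset[OF that finite_drinfeld_indices] that
    by (induction S rule: finite_induct) (use summand in \<open>auto intro!: J_add J_zero\<close>)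
  from this[OF subset_refl] have "(sum ?L ?S - sum ?R ?S) * x - sum ?T ?S \<in> J"
    by (simp only: sum_subtractf left_diff_distrib sum_distrib_right)
  then show ?thesis
    using rel J_cong by blast
qed

text \<open>
  Modulo the contributions of the triples with \<open>n > 0\<close>, the operators \<open>e\<^sub>i\<^sub>l\<close> and \<open>f\<^sub>i\<^sub>k\<close> commute.
\<close>

lemma ee_ff_commute_modulo:
  assumes x: "has_weight \<nu> x" and ik: "(i, k) \<in> I_inf D" and il: "(i, l) \<in> I_inf D"
    and N: "J \<subseteq> N" "\<And>x y. \<lbrakk>x \<in> N; y \<in> N\<rbrakk> \<Longrightarrow> x + y \<in> N" "\<And>x. x \<in> N \<Longrightarrow> - x \<in> N"
    and N_term: "\<And>m n s. \<lbrakk>n > 0; m + n = k; n + s = l\<rbrakk> \<Longrightarrow> drinfeld_term i \<nu> x m n s \<in> N"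
  shows "ee i l * (ff i k * x) - ff i k * (ee i l * x) \<in> N"
proof -
  let ?S = "{(m, n, s). m + n = k \<and> n + s = l}" and ?t = "(k, 0, l)"
  let ?T = "\<lambda>(m, n, s). drinfeld_term i \<nu> x m n s"
  have split: "sum ?T ?S = ?T ?t + sum ?T (?S - {?t})"
    using finite_drinfeld_indices by (intro sum.remove) auto
  have "sum ?T S \<in> N" if "S \<subseteq> ?S - {?t}" for S
    using finite_subset[OF that finite_Diff[OF finite_drinfeld_indices]] that
    by (induction S rule: finite_induct) (use N(1) J_zero in \<open>auto intro!: N(2) N_term\<close>)
  from this[OF subset_refl] have "- sum ?T (?S - {?t}) \<in> N"
    by (rule N(3))
  moreover have "sum ?T ?S \<in> N"
    using sum_drinfeld_term[OF x ik il] N(1) by blast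
  ultimately have "(?T ?t + sum ?T (?S - {?t})) + - sum ?T (?S - {?t}) \<in> N"
    unfolding split by (rule N(2)[rotated])
  then have "?T ?t \<in> N"
    by (simp only: add_uminus_conv_diff add_diff_cancel_right')
  moreover have "\<tau> i 0 = 1"
    using tau_0 I_inf_idx[OF ik] by simp
  ultimately show ?thesis
    by (simp add: drinfeld_term_def scalar_1)
qed


section \<open>Singular vectors of lower weight vanish\<close>

text \<open>The vectors obtained from \<open>w\<close> by applying lowering operators.\<close>

inductive_set lower_orbit :: "('i, 'p) bb_free \<Rightarrow> ('i, 'p) bb_free set" for w where
  base: "w \<in> lower_orbit w"
| ff: "x \<in> lower_orbit w \<Longrightarrow> (i, k) \<in> I_inf D \<Longrightarrow> ff i k * x \<in> lower_orbit w"

text \<open>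
  Their linear span, as a set of representatives: it contains \<open>J\<close>, so that it is a union of classes
  modulo \<open>J\<close>.
\<close>

inductive_set lower_span :: "('i, 'p) bb_free \<Rightarrow> ('i, 'p) bb_free set" for w where
  J: "x \<in> J \<Longrightarrow> x \<in> lower_span w"
| orbit: "x \<in> lower_orbit w \<Longrightarrow> scalar c * x \<in> lower_span w"
| add: "x \<in> lower_span w \<Longrightarrow> y \<in> lower_span w \<Longrightarrow> x + y \<in> lower_span w"

lemma lower_orbit_span: "x \<in> lower_orbit w \<Longrightarrow> x \<in> lower_span w"
  using lower_span.orbit[of x w 1] by (simp add: scalar_1)

lemma lower_orbit_weight:
  assumes "has_weight \<nu> w" "x \<in> lower_orbit w"
  shows "\<exists>\<kappa>. has_weight \<kappa> x"
  using assms(2,1) by (induction rule: lower_orbit.induct) (blast intro: has_weight_ff)+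

lemma lower_span_scalar: "x \<in> lower_span w \<Longrightarrow> scalar c * x \<in> lower_span w"
proof (induction rule: lower_span.induct)
  case (J x)
  then show ?case
    by (intro lower_span.J J_mult free_algebra_scalar)
next
  case (orbit x d)
  then show ?case
    using lower_span.orbit[of x w "c * d"] by (simp add: scalar_mult mult.assoc)
qed (simp add: distrib_left lower_span.add)

lemma lower_span_uminus: "x \<in> lower_span w \<Longrightarrow> - x \<in> lower_span w"
  using lower_span_scalar[of x w "-1"] by (simp add: scalar_uminus scalar_1)

lemma lower_span_cong: "x - y \<in> J \<Longrightarrow> y \<in> lower_span w \<Longrightarrow> x \<in> lower_span w"
  using lower_span.add[OF lower_span.J, of "x - y" y] by simp

lemma lower_span_mult_letter:
  assumes "\<And>x. x \<in> lower_orbit w \<Longrightarrow> a * x \<in> lower_span w" "a \<in> bb_carrier D"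
  shows "x \<in> lower_span w \<Longrightarrow> a * x \<in> lower_span w"
proof (induction rule: lower_span.induct)
  case (J x)
  then show ?case
    using assms by (intro lower_span.J J_mult)
next
  case (orbit x c)
  then show ?case
    using assms(1) by (simp add: scalar_left_commute[of a] lower_span_scalar)
qed (simp add: distrib_left lower_span.add)

lemma lower_span_ff:
  assumes "(i, k) \<in> I_inf D" "x \<in> lower_span w"
  shows "ff i k * x \<in> lower_span w"
proof (rule lower_span_mult_letter[OF _ _ assms(2)])
  show "ff i k * x \<in> lower_span w" if "x \<in> lower_orbit w" for x
    using that assms(1) by (intro lower_orbit_span lower_orbit.ff)
qed (use assms(1) in \<open>simp add: ff_closed\<close>)

lemma lower_span_qh:
  assumes "has_weight \<nu> w" "h \<in> dual_lattice" "x \<in> lower_span w"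
  shows "qh h * x \<in> lower_span w"
proof (rule lower_span_mult_letter[OF _ _ assms(3)])
  fix x assume x: "x \<in> lower_orbit w"
  then obtain \<kappa> where "has_weight \<kappa> x"
    using lower_orbit_weight assms(1) by blast
  from lower_span_cong[OF has_weightD[OF this assms(2)] lower_span.orbit[OF x]]
  show "qh h * x \<in> lower_span w" .
qed (use assms in \<open>simp add: qh_closed\<close>)

text \<open>
  The key step for the span being a submodule when \<open>w\<close> is singular. Besides the induction along the
  orbit there is an inner induction on \<open>l\<close>: the correction terms in the relation between \<open>e\<^sub>i\<^sub>l\<close> and
  \<open>f\<^sub>i\<^sub>k\<close> involve only \<open>e\<^sub>i\<^sub>s\<close> with \<open>s < l\<close>.
\<close>

lemma lower_orbit_ee:
  assumes w: "has_weight \<nu> w" and singular: "\<And>j l. (j, l) \<in> I_inf D \<Longrightarrow> ee j l * w \<in> J"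
  shows "x \<in> lower_orbit w \<Longrightarrow> (j, l) \<in> I_inf D \<Longrightarrow> ee j l * x \<in> lower_span w"
proof (induction arbitrary: j l rule: lower_orbit.induct)
  case base
  then show ?case
    by (intro lower_span.J singular)
next
  case (ff x i k)
  note orbit = \<open>x \<in> lower_orbit w\<close>
  obtain \<kappa> where \<kappa>: "has_weight \<kappa> x"
    using lower_orbit_weight w orbit by blast
  have fe: "ff i k * (ee j l * x) \<in> lower_span w"
    if "k = 0 \<or> (i, k) \<in> I_inf D" "l = 0 \<or> (j, l) \<in> I_inf D" for i k j l
    using that ff.IH[of j l] lower_orbit_span[OF orbit]
    by (cases "k = 0"; cases "l = 0") (simp_all add: ff_0 ee_0 lower_span_ff)
  show ?case
  proof (cases "i = j")
    case False
    have "ee j l * (ff i k * x) - ff i k * (ee j l * x) \<in> J"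
      using ff False by (intro ee_ff_commute has_weight_carrier[OF \<kappa>])
    then show ?thesis
      using fe ff by (blast intro: lower_span_cong)
  next
    case True
    have "ee i l * (ff i k * x) \<in> lower_span w"
      if "k = 0 \<or> (i, k) \<in> I_inf D" "l = 0 \<or> (i, l) \<in> I_inf D" for k l
      using that
    proof (induction l arbitrary: k rule: less_induct)
      case (less l)
      show ?case
      proof (cases "k = 0 \<or> l = 0")
        case True
        then show ?thesis
          using less.prems ff.IH[of i l] lower_orbit_span[OF orbit]
          by (cases "k = 0"; cases "l = 0") (simp_all add: ff_0 ee_0 lower_span_ff)
      next
        case False
        then have kl: "(i, k) \<in> I_inf D" "(i, l) \<in> I_inf D"
          using less.prems by auto
        have "drinfeld_term i \<kappa> x m n s \<in> lower_span w" if "n > 0" "m + n = k" "n + s = l" for m n s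
        proof -
          have ms: "m = 0 \<or> (i, m) \<in> I_inf D" "s = 0 \<or> (i, s) \<in> I_inf D"
            using that kl by (auto dest: I_inf_summand)
          have "ee i s * (ff i m * x) \<in> lower_span w"
            using that ms by (intro less.IH) auto
          moreover have "ff i m * (ee i s * x) \<in> lower_span w"
            using fe ms by blast
          ultimately show ?thesis
            unfolding drinfeld_term_def diff_conv_add_uminus
            by (intro lower_span.add lower_span_scalar lower_span_uminus)
        qed
        then have "ee i l * (ff i k * x) - ff i k * (ee i l * x) \<in> lower_span w"
          by (intro ee_ff_commute_modulo[OF \<kappa> kl])
            (auto intro: lower_span.J lower_span.add lower_span_uminus)
        from lower_span.add[OF this fe[OF less.prems]] show ?thesis
          by simp
      qed
    qed
    then show ?thesis
      using ff True by blast
  qed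
qed

lemma lower_span_left_ideal:
  assumes w: "has_weight \<nu> w" and singular: "\<And>j l. (j, l) \<in> I_inf D \<Longrightarrow> ee j l * w \<in> J"
    and y: "y \<in> lower_span w"
  shows "x \<in> bb_carrier D \<Longrightarrow> x * y \<in> lower_span w"
proof (induction rule: free_algebra_induct)
  case (scalar c)
  show ?case
    by (intro lower_span_scalar y)
next
  case (add x x')
  then show ?case
    by (simp add: distrib_right lower_span.add)
next
  case (letter g x)
  consider h where "g = Q h" "h \<in> dual_lattice" | i l where "g = E i l" "(i, l) \<in> I_inf D"
    | i l where "g = F i l" "(i, l) \<in> I_inf D"
    using letter(1) by (auto simp: generators_def)
  then have "letter g * (x * y) \<in> lower_span w"
  proof cases
    case 1
    then show ?thesis
      using lower_span_qh[OF w _ letter(3)] by (simp add: qh_def)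
  next
    case 2
    have "ee i l * (x * y) \<in> lower_span w"
      by (rule lower_span_mult_letter[OF lower_orbit_ee[OF w singular] ee_closed letter(3)])
        (simp_all add: 2)
    then show ?thesis
      using 2(1) I_inf_idx[OF 2(2)] by (simp add: ee_def)
  next
    case 3
    then show ?thesis
      using lower_span_ff[OF 3(2) letter(3)] I_inf_idx[OF 3(2)] by (simp add: ff_def)
  qed
  then show ?case
    by (simp add: mult.assoc)
qed

text \<open>
  The submodule generated by a singular vector \<open>w\<close> of weight \<open>\<mu> - k \<alpha>\<^sub>i\<close>, \<open>k > 0\<close>, only has
  weights \<open>\<mu> - \<beta>\<close> where \<open>\<beta>\<close> has a positive coefficient at \<open>\<alpha>\<^sub>i\<close>. So it does not contain the highest weight vector, and it is zero by
  irreducibility.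
\<close>

lemma singular_vector_in_J:
  assumes i: "i \<in> idx D" and k: "k > 0"
    and w: "has_weight (\<mu> - int_scale (int k) (root D i)) w"
    and singular: "\<And>j l. (j, l) \<in> I_inf D \<Longrightarrow> ee j l * w \<in> J"
  shows "w \<in> J"
proof -
  let ?B = "root D ` idx D"
  define M where "M = {\<mu> - \<beta> | \<beta>. \<beta> \<in> int_module.span ?B
    \<and> int_module.representation ?B \<beta> (root D i) > 0}"
  have indep: "int_module.independent ?B"
    using datum by (simp add: borcherds_cartan_datum_def)
  have rep: "int_module.representation ?B (int_scale (int k) (root D j)) (root D i)
      = (if root D i = root D j then int k else 0)" if "j \<in> idx D" for j k
    using that indep
    by (simp add: int_module.representation_scale int_module.representation_basis int_module.span_base)
  have span: "int_scale (int k) (root D j) \<in> int_module.span ?B" if "j \<in> idx D" for j k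
    using that by (intro int_module.span_scale int_module.span_base) auto
  have orbit_weight: "\<exists>\<kappa>\<in>M. has_weight \<kappa> x" if "x \<in> lower_orbit w" for x
    using that
  proof (induction rule: lower_orbit.induct)
    case base
    have "\<mu> - int_scale (int k) (root D i) \<in> M"
      using span[OF i, of k] rep[OF i, of k] k unfolding M_def by auto
    then show ?case
      using w by blast
  next
    case (ff x j l)
    then obtain \<beta> where \<beta>: "has_weight (\<mu> - \<beta>) x" "\<beta> \<in> int_module.span ?B"
      "int_module.representation ?B \<beta> (root D i) > 0"
      unfolding M_def by auto
    let ?\<gamma> = "\<beta> + int_scale (int l) (root D j)"
    have j: "j \<in> idx D"
      using I_inf_idx[OF ff(2)] by simp
    have in_span: "?\<gamma> \<in> int_module.span ?B"
      using \<beta>(2) span[OF j] by (rule int_module.span_add)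
    have "int_module.representation ?B ?\<gamma> (root D i)
        = int_module.representation ?B \<beta> (root D i) + (if root D i = root D j then int l else 0)"
      by (simp only: int_module.representation_add[OF indep span[OF j] \<beta>(2)] rep[OF j])
    then have "int_module.representation ?B ?\<gamma> (root D i)
        \<ge> int_module.representation ?B \<beta> (root D i)"
      by simp
    then have "int_module.representation ?B ?\<gamma> (root D i) > 0"
      using \<beta>(3) by simp
    then have "\<mu> - ?\<gamma> \<in> M"
      unfolding M_def mem_Collect_eq using in_span by (intro exI[of _ ?\<gamma>] conjI refl)
    moreover have "has_weight (\<mu> - ?\<gamma>) (ff j l * x)"
      using has_weight_ff[OF \<beta>(1)] ff(2) by (simp add: diff_diff_eq)
    ultimately show ?case
      by (rule bexI[rotated])
  qed
  have sums: "\<exists>n. x \<in> weight_sums M n" if "x \<in> lower_span w" for x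
    using that
  proof (induction rule: lower_span.induct)
    case (J x)
    then have "x \<in> weight_sums M 0" by simp
    then show ?case by blast
  next
    case (orbit x c)
    then obtain \<kappa> where "\<kappa> \<in> M" "has_weight \<kappa> (scalar c * x)"
      using orbit_weight has_weight_scalar by blast
    then have "scalar c * x + 0 \<in> weight_sums M (Suc 0)"
      by (intro weight_sums_SucI) (simp_all add: J_zero)
    then have "scalar c * x \<in> weight_sums M (Suc 0)"
      by (simp only: add_0_right)
    then show ?case
      by blast
  next
    case (add x y)
    then show ?case
      by (blast intro: weight_sums_add)
  qed
  have "\<mu> \<notin> M"
    by (auto simp: M_def int_module.representation_zero)
  have "1 \<notin> lower_span w"
  proof
    assume "1 \<in> lower_span w"
    then obtain n where "1 \<in> weight_sums M n"
      using sums by blast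
    from weight_sums_independent[OF \<open>\<mu> \<notin> M\<close> this has_weight_one] show False
      using one_notin_J by contradiction
  qed
  have "lower_span w \<subseteq> J"
  proof (rule J_maximal)
    show "J \<subseteq> lower_span w"
      using lower_span.J by blast
    show "lower_span w \<subseteq> bb_carrier D"
      using sums weight_sums_carrier by blast
    show "x * y \<in> lower_span w" if "x \<in> bb_carrier D" "y \<in> lower_span w" for x y
      by (rule lower_span_left_ideal[OF w singular that(2,1)])
    show "x + y \<in> lower_span w" if "x \<in> lower_span w" "y \<in> lower_span w" for x y
      using that by (rule lower_span.add)
    show "1 \<notin> lower_span w" by fact
  qed
  then show ?thesis
    by (rule subsetD[OF _ lower_orbit_span[OF lower_orbit.base]])
qed


section \<open>Vanishing for real and imaginary indices\<close>

lemma coroot_shift: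
  assumes "i \<in> idx D" "j \<in> idx D"
  shows "coroot D i (x - int_scale k (root D j)) = coroot D i x - k * cartan D i j"
proof -
  have "coroot D i \<in> dual_lattice" "coroot D i (root D j) = cartan D i j"
    using assms datum unfolding borcherds_cartan_datum_def by blast+
  then show ?thesis
    by (simp add: dual_lattice_diff dual_lattice_int_scale)
qed

lemma has_weight_ff_power:
  assumes "i \<in> I_re D"
  shows "has_weight (\<mu> - int_scale (int n) (root D i)) (ff i 1 ^ n)"
proof (induction n)
  case 0
  then show ?case
    by (simp add: has_weight_one)
next
  case (Suc n)
  have i1: "(i, 1) \<in> I_inf D"
    using assms by (simp add: I_inf_def)
  have "\<mu> - int_scale (int (Suc n)) (root D i)
      = \<mu> - int_scale (int n) (root D i) - int_scale (int 1) (root D i)"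
    by (simp only: of_nat_Suc of_nat_1 int_scale_add_left diff_diff_eq add.commute)
  with has_weight_ff[OF Suc i1] show ?case
    by (simp only: power_Suc)
qed

text \<open>
  The \<open>sl\<^sub>2\<close> computation for a real index; \<open>q\<^bsup>b j\<^esup>\<close> is the eigenvalue of \<open>K\<^sub>i\<close> on \<open>f\<^sub>i\<^sup>j v\<close>. For \<open>n = 0\<close>
  the truncated exponent \<open>n - 1\<close> does not matter, since the sum is empty.
\<close>

lemma ee_ff_power:
  assumes i: "i \<in> I_re D"
  defines "b \<equiv> \<lambda>j. symm D i * (coroot D i \<mu> - 2 * int j)"
  shows "ee i 1 * ff i 1 ^ n
    - scalar (\<tau> i 1 * (\<Sum>j<n. q powi b j - q powi (- b j))) * ff i 1 ^ (n - 1) \<in> J"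
proof (induction n)
  case 0
  have "(i, 1) \<in> I_inf D"
    using i by (simp add: I_inf_def)
  then show ?case
    using J_ee by (simp add: scalar_0)
next
  case (Suc n)
  let ?f = "ff i 1" and ?e = "ee i 1" and ?x = "ff i 1 ^ n"
  let ?c = "\<lambda>n. \<tau> i 1 * (\<Sum>j<n. q powi b j - q powi (- b j))"
  have i1: "(i, 1) \<in> I_inf D" and idx: "i \<in> idx D" and aii: "cartan D i i = 2"
    using i by (simp_all add: I_inf_def I_re_def)
  have \<nu>: "symm D i * coroot D i (\<mu> - int_scale (int n) (root D i)) = b n"
    by (simp add: coroot_shift idx aii b_def)
  have indices: "{(m, n', s). m + n' = (1::nat) \<and> n' + s = (1::nat)} = {(1, 0, 1), (0, 1, 0)}"
    by auto
  have "drinfeld_term i (\<mu> - int_scale (int n) (root D i)) ?x 1 0 1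
      + drinfeld_term i (\<mu> - int_scale (int n) (root D i)) ?x 0 1 0 \<in> J"
    using sum_drinfeld_term[OF has_weight_ff_power[OF i, of n] i1 i1] unfolding indices by simp
  then have commutator: "(?e * (?f * ?x) - ?f * (?e * ?x))
      + (scalar (\<tau> i 1 * q powi (- b n)) * ?x - scalar (\<tau> i 1 * q powi b n) * ?x) \<in> J"
    by (simp add: drinfeld_term_def tau_0[OF idx] ee_0 ff_0 scalar_1 \<nu> mult.assoc)
  have f_scalar: "?f * (scalar (?c n) * ?f ^ (n - 1)) = scalar (?c n) * ?x"
    by (subst scalar_left_commute, cases n) (simp_all add: scalar_0)
  have "?f * (?e * ?x - scalar (?c n) * ?f ^ (n - 1)) \<in> J"
    using i1 by (intro J_mult Suc ff_closed) simp
  then have "?f * (?e * ?x) - scalar (?c n) * ?x \<in> J"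
    unfolding right_diff_distrib f_scalar .
  from J_add[OF this commutator]
  have "?e * (?f * ?x) - (scalar (?c n) + (scalar (\<tau> i 1 * q powi b n)
      - scalar (\<tau> i 1 * q powi (- b n)))) * ?x \<in> J"
    by (simp add: algebra_simps)
  moreover have "?c (Suc n) = ?c n + (\<tau> i 1 * q powi b n - \<tau> i 1 * q powi (- b n))"
    by (simp add: distrib_left right_diff_distrib)
  ultimately show ?case
    by (simp only: scalar_add scalar_diff power_Suc diff_Suc_1)
qed

lemma real_vanishing:
  assumes i: "i \<in> I_re D" and N: "coroot D i \<mu> = int N"
  shows "ff i 1 ^ Suc N \<in> J"
proof (rule singular_vector_in_J)
  have idx: "i \<in> idx D" and i1: "(i, 1) \<in> I_inf D"
    using i by (simp_all add: I_inf_def I_re_def)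
  show "i \<in> idx D" "Suc N > 0"
    using idx by simp_all
  show "has_weight (\<mu> - int_scale (int (Suc N)) (root D i)) (ff i 1 ^ Suc N)"
    by (rule has_weight_ff_power[OF i])
  show "ee j l * ff i 1 ^ Suc N \<in> J" if jl: "(j, l) \<in> I_inf D" for j l
  proof (cases "i = j")
    case True
    then have "l = 1"
      using i jl by (auto simp: I_inf_def I_re_def I_im_def)
    let ?b = "\<lambda>j. symm D i * (coroot D i \<mu> - 2 * int j)"
    \<comment> \<open>The reflection \<open>j \<mapsto> N - j\<close> changes the sign of the exponents.\<close>
    have "(\<Sum>j<Suc N. q powi ?b j) = (\<Sum>j<Suc N. q powi ?b (Suc N - Suc j))"
      by (rule sum.nat_diff_reindex[symmetric])
    also have "\<dots> = (\<Sum>j<Suc N. q powi (- ?b j))"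
      using N by (intro sum.cong) (auto simp: of_nat_diff algebra_simps)
    finally have "(\<Sum>j<Suc N. q powi ?b j - q powi (- ?b j)) = 0"
      by (simp only: sum_subtractf diff_self)
    with ee_ff_power[OF i, of "Suc N"] have "ee i 1 * ff i 1 ^ Suc N - 0 * ff i 1 ^ N \<in> J"
      by (simp only: mult_zero_right scalar_0 diff_Suc_1)
    then show ?thesis
      using True \<open>l = 1\<close> by simp
  next
    case False
    have "ee j l * ff i 1 ^ n \<in> J" for n
    proof (induction n)
      case 0
      then show ?case
        using J_ee[OF jl] by simp
    next
      case (Suc n)
      have "ee j l * (ff i 1 * ff i 1 ^ n) - ff i 1 * (ee j l * ff i 1 ^ n) \<in> J"
        using False i1 by (intro ee_ff_commute i1 jl free_algebra_power ff_closed) simp_all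
      moreover have "ff i 1 * (ee j l * ff i 1 ^ n) \<in> J"
        using i1 by (intro J_mult Suc ff_closed) auto
      ultimately show ?case
        unfolding power_Suc by (rule J_congI)
    qed
    then show ?thesis .
  qed
qed

text \<open>
  By induction on \<open>k\<close>, the triples with \<open>n > 0\<close> other than \<open>m = s = 0\<close> do not contribute to the
  commutator of \<open>e\<^sub>i\<^sub>l\<close> and \<open>f\<^sub>i\<^sub>k\<close> on the highest weight vector; for \<open>m = s = 0\<close> the two sides of the
  relation agree, since \<open>K\<^sub>i\<close> fixes that vector.
\<close>

lemma imaginary_vanishing:
  assumes i: "i \<in> I_im D" and \<mu>: "coroot D i \<mu> = 0"
  shows "k > 0 \<Longrightarrow> ff i k \<in> J"
proof (induction k rule: less_induct)
  case (less k)
  have I_inf: "(i, l) \<in> I_inf D" if "l > 0" for l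
    using i that by (auto simp: I_inf_def I_im_def)
  show ?case
  proof (rule singular_vector_in_J)
    show "i \<in> idx D" "k > 0"
      using i less.prems by (auto simp: I_im_def)
    show "has_weight (\<mu> - int_scale (int k) (root D i)) (ff i k)"
      using has_weight_ff[OF has_weight_one I_inf[OF less.prems]] by simp
    show "ee j l * ff i k \<in> J" if jl: "(j, l) \<in> I_inf D" for j l
    proof (cases "i = j")
      case True
      have "drinfeld_term i \<mu> 1 m n s \<in> J" if "n > 0" "m + n = k" for m n s
      proof -
        have e: "ee i s \<in> J" if "s > 0" for s
          using that by (intro J_ee I_inf)
        have f: "ff i m \<in> J" if "m > 0"
          using that \<open>n > 0\<close> \<open>m + n = k\<close> by (intro less.IH) auto
        have A: "scalar c \<in> bb_carrier D" "ee i s \<in> bb_carrier D" "ff i m \<in> bb_carrier D" for c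
          by (auto intro: free_algebra_scalar ee_closed ff_closed I_inf)
        show ?thesis
        proof (cases "m = 0 \<and> s = 0")
          case True
          then show ?thesis
            by (simp add: drinfeld_term_def \<mu> J_zero ee_0 ff_0)
        next
          case False
          then have "ee i s * ff i m \<in> J" "ff i m * ee i s \<in> J"
            using e f A by (cases "m = 0"; cases "s = 0"; auto simp: ee_0 ff_0 intro: J_mult)+
          then show ?thesis
            using A by (auto simp: drinfeld_term_def intro!: J_diff J_mult)
        qed
      qed
      then have "ee i l * (ff i k * 1) - ff i k * (ee i l * 1) \<in> J"
        using True jl I_inf[OF less.prems]
        by (intro ee_ff_commute_modulo[OF has_weight_one]) (auto intro: J_add J_uminus)
      moreover have "ff i k * (ee i l * 1) \<in> J"
        using J_ee[OF jl] True I_inf[OF less.prems] by (auto intro!: J_mult ff_closed)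
      ultimately have "ee i l * (ff i k * 1) \<in> J"
        by (rule J_congI)
      then show ?thesis
        using True by simp
    next
      case False
      have "ee j l * (ff i k * 1) - ff i k * (ee j l * 1) \<in> J"
        by (intro ee_ff_commute I_inf[OF less.prems] jl False free_algebra_one)
      moreover have "ff i k * (ee j l * 1) \<in> J"
        using J_ee[OF jl] I_inf[OF less.prems] by (auto intro!: J_mult ff_closed)
      ultimately have "ee j l * (ff i k * 1) \<in> J"
        by (rule J_congI)
      then show ?thesis
        by simp
    qed
  qed
qed

end

theorem proposition4p2:
  fixes D :: "('i, 'p::ab_group_add) bc_datum"
    and \<tau> :: "'i \<Rightarrow> nat \<Rightarrow> Qq"
    and \<mu> :: 'p
    and V :: "(('i, 'p) bb_free set, 'v) module"
    and v :: 'v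
  assumes "borcherds_cartan_datum D"
    and "admissible_tau D \<tau>"
    and "\<mu> \<in> dominant_weights D"
    and "irreducible_highest_weight_module D \<tau> V \<mu> v"
  shows "(\<forall>i\<in>I_re D.
            (U_class D \<tau> (ff i 1) [^]\<^bsub>U_q D \<tau>\<^esub> (nat (coroot D i \<mu>) + 1)) \<odot>\<^bsub>V\<^esub> v = \<zero>\<^bsub>V\<^esub>) \<and>
         (\<forall>i\<in>I_im D. coroot D i \<mu> = 0 \<longrightarrow>
            (\<forall>k>0. U_class D \<tau> (ff i k) \<odot>\<^bsub>V\<^esub> v = \<zero>\<^bsub>V\<^esub>))"
proof -
  interpret U: ring_hom_ring "free_algebra (generators D)" "U_q D \<tau>" "U_class D \<tau>"
    by (rule U_class_hom[OF assms(1)])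
  interpret highest_weight_ideal D \<tau> \<mu> "{x \<in> bb_carrier D. U_class D \<tau> x \<odot>\<^bsub>V\<^esub> v = \<zero>\<^bsub>V\<^esub>}"
    by (rule annihilator_highest_weight_ideal[OF assms(1,2,4)])
  have power: "U_class D \<tau> (x ^ n) = U_class D \<tau> x [^]\<^bsub>U_q D \<tau>\<^esub> n" if "x \<in> bb_carrier D" for x n
  proof -
    have "x [^]\<^bsub>free_algebra (generators D)\<^esub> n = x ^ n"
      by (induction n) (simp_all add: free_algebra_simps power_commutes)
    then show ?thesis
      using U.hom_nat_pow[OF that, of n] by simp
  qed
  have "(U_class D \<tau> (ff i 1) [^]\<^bsub>U_q D \<tau>\<^esub> (nat (coroot D i \<mu>) + 1)) \<odot>\<^bsub>V\<^esub> v = \<zero>\<^bsub>V\<^esub>"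
    if i: "i \<in> I_re D" for i
  proof -
    have "coroot D i \<mu> = int (nat (coroot D i \<mu>))"
      using i assms(3) by (simp add: dominant_weights_def I_re_def)
    note vanishing = real_vanishing[OF i this]
    have "ff i 1 \<in> bb_carrier D"
      using i by (intro ff_closed) (simp add: I_inf_def)
    from power[OF this, of "nat (coroot D i \<mu>) + 1", symmetric] show ?thesis
      using vanishing by simp
  qed
  moreover have "U_class D \<tau> (ff i k) \<odot>\<^bsub>V\<^esub> v = \<zero>\<^bsub>V\<^esub>"
    if "i \<in> I_im D" "coroot D i \<mu> = 0" "k > 0" for i k
    using imaginary_vanishing[OF that] by simp
  ultimately show ?thesis
    by simp
qed

end
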